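(* Let $K$ be a local field of characteristic $p$ with residue field $k$, $|k|=p^d$, let $\bar\phi:A\to k[\tau]$ be a Drinfeld $A$-module over $k$, viewed as a Drinfeld module of good reduction over $\mathcal O_K$ via $k\hookrightarrow\mathcal O_K$, and let $\bar\omega$ be the basic Drinfeld module over $k$. Then the natural isomorphism $\theta:T^\circ_{\rm ad}(\bar\phi)\to T^\circ_{\rm ad}(\bar\omega)$ identifies the local Kummer pairing of $\bar\phi$ with that of $\bar\omega$; that is, for all $[\xi]\in\mathcal P_{K^{\rm perf}}$ and $[\gamma]\in J_K$ we have $$\theta\bigl([\xi,\gamma)_{\bar\phi}\bigr)=[\xi,\gamma)_{\bar\omega}.$$
   Context: Fields. $K$ is a local field of characteristic $p$ with finite residue field $k$, $|k|=p^d$; $K^{\rm alg}$ is an algebraic closure and $K^{\rm perf}\subset K^{\rm alg}$ the perfection of $K$. For an intermediate field $K'$ of $K^{\rm alg}/K$, $\mathcal O_{K'}$ and $\mathfrak m_{K'}$ denote its valuation ring and maximal ideal; $\mathcal O_{K^{\rm alg}}/\mathfrak m_{K^{\rm alg}}=k^{\rm alg}$. There is a unique ring section $k\hookrightarrow\mathcal O_K$ of $\mathcal O_K\to k$. $\mathcal P_{K^{\rm perf}}:=K^{\rm perf}/\mathcal O_{K^{\rm perf}}$. $I_K\subset\mathrm{Gal}(K^{\rm alg}/K^{\rm perf})\cong\mathrm{Gal}(K^{\rm sep}/K)$ is the inertia group and $J_K:=I_K^{\rm ab}/(I_K^{\rm ab})^p$ its maximal quotient that is abelian of exponent $p$. Drinfeld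 modules. $A$ is the ring of elements of a global function field $F$ of characteristic $p$ that are regular outside a fixed place $\infty$. $R:=k[\tau]$ with $\tau x=x^p\tau$; polynomials $\sum f_i\tau^i$ act by $\xi\mapsto\sum f_i\xi^{p^i}$. $\bar\phi:A\to R$, $a\mapsto\bar\phi_a$, is a Drinfeld $A$-module of positive rank. $B:=\mathbb F_p[s]$, $E:=\mathrm{Quot}(B)$, and $\bar\omega:B\to R$ is the Drinfeld $B$-module with $\bar\omega_s=\tau^d$. Put $T^\circ_{\rm ad}(\bar\phi):=\mathrm{Hom}_A\bigl(F/A,(K^{\rm alg}/\mathfrak m_{K^{\rm alg}},\bar\phi)\bigr)$ with $A$ acting through $\bar\phi$, and $T^\circ_{\rm ad}(\bar\omega):=\mathrm{Hom}_B\bigl(E/B,(K^{\rm alg}/\mathfrak m_{K^{\rm alg}},\bar\omega)\bigr)$. All these homomorphisms take values in $k^{\rm alg}=\mathcal O_{K^{\rm alg}}/\mathfrak m_{K^{\rm alg}}$. Local Kummer pairing. For $\xi\in K^{\rm perf}$ and $\gamma\in I_K$, $[\xi,\gamma)_{\bar\phi}\in T^\circ_{\rm ad}(\bar\phi)$ is the $A$-linear map sending $\frac ba+A$ ($a,b\in A$, $a\ne0$) to $[\bar\phi_b(\gamma(\xi_a)-\xi_a)]$, where $\xi_a\in K^{\rm alg}$ is any element with $\bar\phi_a(\xi_a)=\xi$. It is well defined and depends only on $[\xi]\in\mathcal P_{K^{\rm perf}}$ and $[\gamma]\in J_K$. The pairing $[\ ,\ )_{\bar\omega}$ is defined in the same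 way with $(B,\bar\omega)$ in place of $(A,\bar\phi)$. Isomorphism $\theta$. Let $D$ be the total ring of quotients of $R$. The map $f\otimes ab^{-1}\mapsto f\bar\phi_a\bar\phi_b^{-1}$ is an isomorphism $R\otimes_AF\to D$, where $R$ is a right $A$-module via $\bar\phi$, and induces an isomorphism of left $R$-modules $R\otimes_A(F/A)\cong D/R$. In the same way $R\otimes_B(E/B)\cong D/R$. By adjunction these give isomorphisms $$\mathrm{Hom}_A(F/A,(k^{\rm alg},\bar\phi))\cong\mathrm{Hom}_R(D/R,k^{\rm alg})\cong\mathrm{Hom}_B(E/B,(k^{\rm alg},\bar\omega)),$$ where $\ell$ on the left corresponds to $[f\bar\phi_a^{-1}]\mapsto f(\ell(\tfrac1a+A))$ for $f\in R$, and similarly on the right. Their composite is $\theta$. *)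

theory Defs
  imports
    "HOL-Analysis.Analysis"
    "HOL-Algebra.Generated_Groups"
    "HOL-Computational_Algebra.Computational_Algebra"
    "HOL-Library.Set_Algebras"
begin

section \<open>Subrings and subfields of a ring type\<close>

definition is_subring :: "'a::ring_1 set \<Rightarrow> bool" where
  "is_subring S \<longleftrightarrow> 0 \<in> S \<and> 1 \<in> S \<and> (\<forall>x\<in>S. \<forall>y\<in>S. x - y \<in> S \<and> x * y \<in> S)"

definition is_subfield :: "'a::field set \<Rightarrow> bool" where
  "is_subfield S \<longleftrightarrow> is_subring S \<and> (\<forall>x\<in>S. inverse x \<in> S)"

definition ring_hom_on :: "'a::ring_1 set \<Rightarrow> ('a \<Rightarrow> 'b::ring_1) \<Rightarrow> bool" where
  "ring_hom_on S h \<longleftrightarrow>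
     h 1 = 1 \<and> (\<forall>x\<in>S. \<forall>y\<in>S. h (x + y) = h x + h y \<and> h (x * y) = h x * h y)"

definition algebraic_over :: "'a::field set \<Rightarrow> 'a \<Rightarrow> bool" where
  "algebraic_over K x \<longleftrightarrow> (\<exists>q. q \<noteq> 0 \<and> range (coeff q) \<subseteq> K \<and> poly q x = 0)"


section \<open>Quotients by additive subgroups\<close>

definition quot :: "'a::ab_group_add set \<Rightarrow> 'a set \<Rightarrow> 'a set set" where
  "quot M N = (\<lambda>x. x +o N) ` M"

text \<open>
  The map of cosets induced by \<open>g\<close>, namely \<open>x + N \<mapsto> g x + N'\<close>; the union is over equal sets
  as soon as the induced map is well defined.
\<close>

definition induced :: "('a \<Rightarrow> 'b::ab_group_add) \<Rightarrow> 'b set \<Rightarrow> 'a set \<Rightarrow> 'b set" where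
  "induced g N' X = (\<Union>x\<in>X. g x +o N')"

text \<open>
  Additive maps \<open>M/N \<rightarrow> M'/N'\<close> commuting with the operators \<open>\<alpha> r\<close> and \<open>\<beta> r\<close> for \<open>r \<in> S\<close>, i.e.
  homomorphisms of left \<open>S\<close>-modules. They are extensional functions, so that equality of maps is
  equality of functions.
\<close>

definition quot_homs ::
  "'r set \<Rightarrow> ('r \<Rightarrow> 'a::ab_group_add \<Rightarrow> 'a) \<Rightarrow> 'a set \<Rightarrow> 'a set \<Rightarrow>
   ('r \<Rightarrow> 'b::ab_group_add \<Rightarrow> 'b) \<Rightarrow> 'b set \<Rightarrow> 'b set \<Rightarrow> ('a set \<Rightarrow> 'b set) set" where
  "quot_homs S \<alpha> M N \<beta> M' N' =
     {l \<in> quot M N \<rightarrow>\<^sub>E quot M' N'.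
        (\<forall>X\<in>quot M N. \<forall>Y\<in>quot M N. l (X + Y) = l X + l Y) \<and>
        (\<forall>r\<in>S. \<forall>X\<in>quot M N. l (induced (\<alpha> r) N X) = induced (\<beta> r) N' (l X))}"


section \<open>Local fields inside an algebraic closure\<close>

definition nonarch_absolute_value :: "('a::field \<Rightarrow> real) \<Rightarrow> bool" where
  "nonarch_absolute_value v \<longleftrightarrow>
     (\<forall>x. v x \<ge> 0) \<and> (\<forall>x. v x = 0 \<longleftrightarrow> x = 0) \<and>
     (\<forall>x y. v (x * y) = v x * v y) \<and> (\<forall>x y. v (x + y) \<le> max (v x) (v y))"

definition val_ring :: "('a \<Rightarrow> real) \<Rightarrow> 'a set \<Rightarrow> 'a set" where
  "val_ring v K' = {x \<in> K'. v x \<le> 1}"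

definition max_ideal :: "('a \<Rightarrow> real) \<Rightarrow> 'a set \<Rightarrow> 'a set" where
  "max_ideal v K' = {x \<in> K'. v x < 1}"

definition discretely_valued :: "('a::field \<Rightarrow> real) \<Rightarrow> 'a set \<Rightarrow> bool" where
  "discretely_valued v K \<longleftrightarrow>
     (\<exists>\<pi>\<in>K. 0 < v \<pi> \<and> v \<pi> < 1 \<and> (\<forall>x\<in>K - {0}. \<exists>n::int. v x = v \<pi> powi n))"

definition complete_valued :: "('a::field \<Rightarrow> real) \<Rightarrow> 'a set \<Rightarrow> bool" where
  "complete_valued v K \<longleftrightarrow>
     (\<forall>X::nat \<Rightarrow> 'a. range X \<subseteq> K \<and> (\<forall>e>0. \<exists>N. \<forall>m\<ge>N. \<forall>n\<ge>N. v (X m - X n) < e)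
        \<longrightarrow> (\<exists>l\<in>K. (\<lambda>n. v (X n - l)) \<longlonglongrightarrow> 0))"

text \<open>
  \<open>res\<close> exhibits the type \<open>'k\<close> as the residue field of \<open>K\<close>: it is a surjective ring homomorphism
  on the valuation ring whose kernel is the maximal ideal. The finiteness of the residue
  field is the sort constraint \<open>finite_field\<close>.
\<close>

definition residue_map ::
  "('a::field \<Rightarrow> real) \<Rightarrow> 'a set \<Rightarrow> ('a \<Rightarrow> 'k::finite_field) \<Rightarrow> bool" where
  "residue_map v K res \<longleftrightarrow>
     ring_hom_on (val_ring v K) res \<and> res ` val_ring v K = UNIV \<and>
     (\<forall>x\<in>val_ring v K. res x = 0 \<longleftrightarrow> x \<in> max_ideal v K)"

text \<open>
  The type \<open>'a\<close> is an algebraic closure of the subfield \<open>K\<close>. The absolute value \<open>v\<close> lives on all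
  of \<open>'a\<close>; since the absolute value of a complete field extends uniquely to an algebraic
  closure, this is the same datum as the absolute value on \<open>K\<close>.
\<close>

definition local_field ::
  "('a::alg_closed_field \<Rightarrow> real) \<Rightarrow> 'a set \<Rightarrow> ('a \<Rightarrow> 'k::finite_field) \<Rightarrow> bool" where
  "local_field v K res \<longleftrightarrow>
     is_subfield K \<and> (\<forall>x. algebraic_over K x) \<and>
     nonarch_absolute_value v \<and> discretely_valued v K \<and> complete_valued v K \<and>
     residue_map v K res"

definition residue_section ::
  "('a::field \<Rightarrow> real) \<Rightarrow> 'a set \<Rightarrow> ('a \<Rightarrow> 'k::finite_field) \<Rightarrow> ('k \<Rightarrow> 'a) \<Rightarrow> bool" where
  "residue_section v K res \<iota> \<longleftrightarrow>
     ring_hom_on UNIV \<iota> \<and> range \<iota> \<subseteq> val_ring v K \<and> (\<forall>c. res (\<iota> c) = c)"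

definition perfection :: "'a::field set \<Rightarrow> 'a set" where
  "perfection K = {x. \<exists>n. x ^ (CHAR('a) ^ n) \<in> K}"


section \<open>Galois and inertia groups\<close>

definition galois_group :: "'a::field set \<Rightarrow> ('a \<Rightarrow> 'a) monoid" where
  "galois_group K' =
     \<lparr>carrier = {\<sigma>. bij \<sigma> \<and> ring_hom_on UNIV \<sigma> \<and> (\<forall>x\<in>K'. \<sigma> x = x)}, mult = (\<circ>), one = id\<rparr>"

definition inertia_group :: "('a::field \<Rightarrow> real) \<Rightarrow> 'a set \<Rightarrow> ('a \<Rightarrow> 'a) monoid" where
  "inertia_group v K = (galois_group (perfection K))
     \<lparr>carrier := {\<sigma> \<in> carrier (galois_group (perfection K)).
                   \<forall>x\<in>val_ring v UNIV. \<sigma> x - x \<in> max_ideal v UNIV}\<rparr>"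

text \<open>The topology of pointwise convergence in the discrete field \<open>'a\<close>, i.e. the Krull topology.\<close>

definition krull_topology :: "('a \<Rightarrow> 'a) set \<Rightarrow> ('a \<Rightarrow> 'a) topology" where
  "krull_topology G =
     subtopology (product_topology (\<lambda>_. discrete_topology UNIV) UNIV) G"

text \<open>
  The abelianization of a profinite group is the quotient by the closure of its commutator
  subgroup.
\<close>

definition profinite_ab :: "('a \<Rightarrow> 'a) monoid \<Rightarrow> ('a \<Rightarrow> 'a) set monoid" where
  "profinite_ab G = G Mod (krull_topology (carrier G) closure_of derived G (carrier G))"

definition mod_powers :: "nat \<Rightarrow> 'g monoid \<Rightarrow> 'g set monoid" where
  "mod_powers n G = G Mod ((\<lambda>g. g [^]\<^bsub>G\<^esub> n) ` carrier G)"

definition J_group :: "('a::field \<Rightarrow> real) \<Rightarrow> 'a set \<Rightarrow> ('a \<Rightarrow> 'a) set set monoid" where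
  "J_group v K = mod_powers CHAR('a) (profinite_ab (inertia_group v K))"


section \<open>Skew polynomials\<close>

text \<open>The ring \<open>k[\<tau>]\<close> with \<open>\<tau> x = x\<^sup>p \<tau>\<close>, where \<open>p\<close> is the characteristic of \<open>k\<close>.\<close>

typedef (overloaded) 'a skew_poly = "{f :: nat \<Rightarrow> 'a::zero. \<forall>\<^sub>\<infinity> n. f n = 0}"
  morphisms skew_coeff Abs_skew_poly
  by (auto intro!: exI[of _ "\<lambda>_. 0"])

setup_lifting type_definition_skew_poly

lemma skew_poly_eqI: "(\<And>n. skew_coeff f n = skew_coeff g n) \<Longrightarrow> f = g"
  by (metis ext skew_coeff_inject)

instantiation skew_poly :: (ab_group_add) ab_group_add
begin

lift_definition zero_skew_poly :: "'a skew_poly" is "\<lambda>_. 0" by simp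

lift_definition plus_skew_poly :: "'a skew_poly \<Rightarrow> 'a skew_poly \<Rightarrow> 'a skew_poly"
  is "\<lambda>f g n. f n + g n"
  by (drule (1) eventually_conj, erule eventually_mono) simp

lift_definition minus_skew_poly :: "'a skew_poly \<Rightarrow> 'a skew_poly \<Rightarrow> 'a skew_poly"
  is "\<lambda>f g n. f n - g n"
  by (drule (1) eventually_conj, erule eventually_mono) simp

lift_definition uminus_skew_poly :: "'a skew_poly \<Rightarrow> 'a skew_poly"
  is "\<lambda>f n. - f n"
  by simp

instance
  by standard (transfer; auto simp: fun_eq_iff algebra_simps)+

end

instantiation skew_poly :: (field_prime_char) ring_1
begin

lift_definition one_skew_poly :: "'a skew_poly" is "\<lambda>n. if n = 0 then 1 else 0"
  by (auto simp: MOST_nat intro!: exI[of _ 0])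

lift_definition times_skew_poly :: "'a skew_poly \<Rightarrow> 'a skew_poly \<Rightarrow> 'a skew_poly"
  is "\<lambda>f g n. \<Sum>i=0..n. f i * g (n - i) ^ (CHAR('a) ^ i)"
proof -
  fix f g :: "nat \<Rightarrow> 'a"
  assume "\<forall>\<^sub>\<infinity> n. f n = 0" "\<forall>\<^sub>\<infinity> n. g n = 0"
  then obtain a b where ab: "\<And>n. n > a \<Longrightarrow> f n = 0" "\<And>n. n > b \<Longrightarrow> g n = 0"
    unfolding MOST_nat by blast
  have "(\<Sum>i=0..n. f i * g (n - i) ^ (CHAR('a) ^ i)) = 0" if "n > a + b" for n
  proof (intro sum.neutral ballI)
    fix i
    show "f i * g (n - i) ^ (CHAR('a) ^ i) = 0"
    proof (cases "i > a")
      case False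
      then have "g (n - i) = 0" using that by (intro ab) auto
      then show ?thesis by simp
    qed (simp add: ab)
  qed
  then show "\<forall>\<^sub>\<infinity> n. (\<Sum>i=0..n. f i * g (n - i) ^ (CHAR('a) ^ i)) = 0"
    unfolding MOST_nat by blast
qed

instance
proof
  fix a b c :: "'a skew_poly"
  let ?p = "CHAR('a)"
  have p: "prime ?p"
    by (simp add: prime_CHAR_semidom)
  show "a * b * c = a * (b * c)"
  proof (rule skew_poly_eqI)
    fix n
    let ?A = "skew_coeff a" and ?B = "skew_coeff b" and ?C = "skew_coeff c"
    let ?F = "\<lambda>i j l. ?A i * ?B j ^ (?p ^ i) * ?C l ^ (?p ^ (i + j))"
    have "skew_coeff (a * b * c) n = (\<Sum>j=0..n. \<Sum>i=0..j. ?F i (j - i) (n - j))"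
      by (simp add: times_skew_poly.rep_eq sum_distrib_right)
    also have "\<dots> = (\<Sum>j=0..n. \<Sum>i=0..n - j. ?F j i (n - j - i))"
      by (rule fps_mult_assoc_lemma)
    also have "\<dots> = skew_coeff (a * (b * c)) n"
      by (simp add: times_skew_poly.rep_eq freshmans_dream_sum'[OF p refl] sum_distrib_left
          power_mult_distrib mult.assoc power_mult [symmetric] power_add mult.commute)
    finally show "skew_coeff (a * b * c) n = skew_coeff (a * (b * c)) n" .
  qed
  show "1 * a = a"
    by (rule skew_poly_eqI)
       (simp add: times_skew_poly.rep_eq one_skew_poly.rep_eq if_distrib[of "\<lambda>x. x * _"] cong: if_cong)
  show "a * 1 = a"
  proof (rule skew_poly_eqI)
    fix n
    have "skew_coeff (a * 1) n = (\<Sum>i=0..n. if i = n then skew_coeff a n else 0)"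
      unfolding times_skew_poly.rep_eq one_skew_poly.rep_eq using p
      by (intro sum.cong) (auto simp: prime_gt_0_nat)
    then show "skew_coeff (a * 1) n = skew_coeff a n" by simp
  qed
  show "(a + b) * c = a * c + b * c"
    by (rule skew_poly_eqI)
       (simp add: times_skew_poly.rep_eq plus_skew_poly.rep_eq distrib_right sum.distrib)
  show "a * (b + c) = a * b + a * c"
    by (rule skew_poly_eqI)
       (simp add: times_skew_poly.rep_eq plus_skew_poly.rep_eq freshmans_dream'[OF p refl]
          distrib_left sum.distrib)
  show "(0::'a skew_poly) \<noteq> 1"
    by transfer (auto simp: fun_eq_iff)
qed

end

lift_definition skew_const :: "'a::field_prime_char \<Rightarrow> 'a skew_poly"
  is "\<lambda>c n. if n = 0 then c else 0"
  by (auto simp: MOST_nat intro!: exI[of _ 0])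

lift_definition tau :: "'a::field_prime_char skew_poly" is "\<lambda>n. if n = 1 then 1 else 0"
  by (auto simp: MOST_nat intro!: exI[of _ 1])

lemma tau_mult_const: "tau * skew_const (x::'a::field_prime_char) = skew_const (x ^ CHAR('a)) * tau"
proof (rule skew_poly_eqI)
  fix n
  show "skew_coeff (tau * skew_const x) n = skew_coeff (skew_const (x ^ CHAR('a)) * tau) n"
    unfolding times_skew_poly.rep_eq tau.rep_eq skew_const.rep_eq
    by (cases n; cases "n - 1")
       (auto simp: if_distrib[of "\<lambda>x. x * _"] if_distrib[of "\<lambda>x. _ * x"] sum.atLeast0_atMost_Suc_shift
             simp del: sum.atLeast0_atMost_Suc cong: if_cong)
qed

text \<open>
  The action \<open>\<xi> \<mapsto> \<Sum> f\<^sub>i \<xi> ^ (p ^ i)\<close> of \<open>k[\<tau>]\<close> on an extension field \<open>'a\<close> of \<open>k\<close>, where the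
  coefficients are viewed in \<open>'a\<close> through \<open>\<iota>\<close>.
\<close>

definition skew_eval :: "('k::field_prime_char \<Rightarrow> 'a::field) \<Rightarrow> 'k skew_poly \<Rightarrow> 'a \<Rightarrow> 'a" where
  "skew_eval \<iota> f x = (\<Sum>i | skew_coeff f i \<noteq> 0. \<iota> (skew_coeff f i) * x ^ (CHAR('k) ^ i))"

text \<open>
  \<open>j\<close> exhibits the division ring \<open>'d\<close> as the total ring of quotients of the domain \<open>'r\<close>.
\<close>

definition total_quotient_ring :: "('r::ring_1 \<Rightarrow> 'd::division_ring) \<Rightarrow> bool" where
  "total_quotient_ring j \<longleftrightarrow>
     ring_hom_on UNIV j \<and> inj j \<and> (\<forall>x. \<exists>f g. g \<noteq> 0 \<and> x = j f / j g)"


section \<open>Drinfeld modules\<close>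

text \<open>
  A finite extension of the rational function field over \<open>'p\<close>, which is to be the field with
  \<open>p\<close> elements.
\<close>

definition global_function_field :: "'p::finite_field itself \<Rightarrow> 'f::field itself \<Rightarrow> bool" where
  "global_function_field _ _ \<longleftrightarrow>
     (\<exists>(h :: 'p poly fract \<Rightarrow> 'f) S. ring_hom_on UNIV h \<and> finite S \<and>
        (\<forall>x. \<exists>c. x = (\<Sum>s\<in>S. h (c s) * s)))"

text \<open>Places of a function field, represented by their valuation rings.\<close>

definition places :: "'f::field set set" where
  "places = {V. is_subring V \<and> V \<noteq> UNIV \<and> (\<forall>x. x \<in> V \<or> inverse x \<in> V)}"

definition regular_outside :: "'f::field set \<Rightarrow> 'f set" where
  "regular_outside infty = {x. \<forall>V\<in>places - {infty}. x \<in> V}"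

text \<open>
  The rank is the \<open>r\<close> with \<open>deg\<^sub>\<tau> \<phi>\<^sub>a = r deg a\<close>, so it is positive if and only if \<open>\<phi>\<close> does not
  take values in the constants.
\<close>

definition drinfeld_module :: "'f::field set \<Rightarrow> ('f \<Rightarrow> 'k::field_prime_char skew_poly) \<Rightarrow> bool" where
  "drinfeld_module A \<phi> \<longleftrightarrow> ring_hom_on A \<phi> \<and> (\<exists>a\<in>A. \<exists>i>0. skew_coeff (\<phi> a) i \<noteq> 0)"

definition poly_subring :: "'a::field poly fract set" where
  "poly_subring = range (\<lambda>b. Fraction_Field.Fract b 1)"

definition basic_drinfeld_module ::
  "nat \<Rightarrow> ('p::field poly fract \<Rightarrow> 'k::field_prime_char skew_poly) \<Rightarrow> bool" where
  "basic_drinfeld_module d \<omega> \<longleftrightarrow>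
     drinfeld_module poly_subring \<omega> \<and> \<omega> (Fraction_Field.Fract [:0, 1:] 1) = tau ^ d"

text \<open>
  \<open>T\<^sup>\<circ>\<^sub>a\<^sub>d(\<phi>) = Hom\<^sub>A(F/A, K\<^sup>a\<^sup>l\<^sup>g/\<mm>)\<close> with \<open>F\<close> the whole type \<open>'f\<close> and \<open>K\<^sup>a\<^sup>l\<^sup>g\<close> the whole type \<open>'a\<close>.
\<close>

definition T_ad ::
  "('a::field \<Rightarrow> real) \<Rightarrow> ('k::field_prime_char \<Rightarrow> 'a) \<Rightarrow> 'f::field set \<Rightarrow> ('f \<Rightarrow> 'k skew_poly) \<Rightarrow>
   ('f set \<Rightarrow> 'a set) set" where
  "T_ad v \<iota> A \<phi> = quot_homs A (*) UNIV A (\<lambda>a. skew_eval \<iota> (\<phi> a)) UNIV (max_ideal v UNIV)"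


section \<open>The isomorphism theta\<close>

text \<open>\<open>Hom\<^sub>R(D/R, k\<^sup>a\<^sup>l\<^sup>g)\<close>, where \<open>k\<^sup>a\<^sup>l\<^sup>g\<close> is the residue field of \<open>K\<^sup>a\<^sup>l\<^sup>g\<close>.\<close>

definition R_homs ::
  "('a::field \<Rightarrow> real) \<Rightarrow> ('k::field_prime_char \<Rightarrow> 'a) \<Rightarrow> ('k skew_poly \<Rightarrow> 'd::division_ring) \<Rightarrow>
   ('d set \<Rightarrow> 'a set) set" where
  "R_homs v \<iota> j =
     quot_homs UNIV (\<lambda>f x. j f * x) UNIV (range j)
       (skew_eval \<iota>) (val_ring v UNIV) (max_ideal v UNIV)"

text \<open>
  \<open>\<ell> \<in> Hom\<^sub>A(F/A, k\<^sup>a\<^sup>l\<^sup>g)\<close> and \<open>\<Lambda> \<in> Hom\<^sub>R(D/R, k\<^sup>a\<^sup>l\<^sup>g)\<close> correspond to each other if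
  \<open>\<Lambda> [f \<phi>\<^sub>a\<^sup>-\<^sup>1] = f (\<ell> (1/a + A))\<close> for all \<open>f\<close> and \<open>a\<close>.
\<close>

definition adjoint ::
  "('a::field \<Rightarrow> real) \<Rightarrow> ('k::field_prime_char \<Rightarrow> 'a) \<Rightarrow> ('k skew_poly \<Rightarrow> 'd::division_ring) \<Rightarrow>
   'f::field set \<Rightarrow> ('f \<Rightarrow> 'k skew_poly) \<Rightarrow> ('f set \<Rightarrow> 'a set) \<Rightarrow> ('d set \<Rightarrow> 'a set) \<Rightarrow> bool" where
  "adjoint v \<iota> j A \<phi> l \<Lambda> \<longleftrightarrow>
     l \<in> T_ad v \<iota> A \<phi> \<and> \<Lambda> \<in> R_homs v \<iota> j \<and>
     (\<forall>f. \<forall>a\<in>A - {0}.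
        \<Lambda> ((j f / j (\<phi> a)) +o range j) =
        induced (skew_eval \<iota> f) (max_ideal v UNIV) (l ((1 / a) +o A)))"

definition theta ::
  "('a::field \<Rightarrow> real) \<Rightarrow> ('k::field_prime_char \<Rightarrow> 'a) \<Rightarrow> ('k skew_poly \<Rightarrow> 'd::division_ring) \<Rightarrow>
   'f::field set \<Rightarrow> ('f \<Rightarrow> 'k skew_poly) \<Rightarrow> 'e::field set \<Rightarrow> ('e \<Rightarrow> 'k skew_poly) \<Rightarrow>
   ('f set \<Rightarrow> 'a set) \<Rightarrow> ('e set \<Rightarrow> 'a set)" where
  "theta v \<iota> j A \<phi> B \<omega> l =
     (THE l'. \<exists>\<Lambda>. adjoint v \<iota> j A \<phi> l \<Lambda> \<and> adjoint v \<iota> j B \<omega> l' \<Lambda>)"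


section \<open>The local Kummer pairing\<close>

definition kummer_pairing_rep ::
  "('a::field \<Rightarrow> real) \<Rightarrow> ('k::field_prime_char \<Rightarrow> 'a) \<Rightarrow> 'f::field set \<Rightarrow> ('f \<Rightarrow> 'k skew_poly) \<Rightarrow>
   'a \<Rightarrow> ('a \<Rightarrow> 'a) \<Rightarrow> ('f set \<Rightarrow> 'a set)" where
  "kummer_pairing_rep v \<iota> A \<phi> \<xi> \<gamma> =
     (\<lambda>Q\<in>quot UNIV A. the_elem
        {skew_eval \<iota> (\<phi> b) (\<gamma> x - x) +o max_ideal v UNIV | a b x.
           a \<in> A \<and> b \<in> A \<and> a \<noteq> 0 \<and> Q = (b / a) +o A \<and> skew_eval \<iota> (\<phi> a) x = \<xi>})"

text \<open>
  The pairing on the classes \<open>X\<close> of \<open>\<xi>\<close> and \<open>C\<close> of \<open>\<gamma>\<close>. An element of the group \<open>J\<^sub>K\<close> is a set of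
  cosets in the inertia group, so its representatives are the elements of \<open>\<Union>C\<close>.
\<close>

definition kummer_pairing ::
  "('a::field \<Rightarrow> real) \<Rightarrow> ('k::field_prime_char \<Rightarrow> 'a) \<Rightarrow> 'f::field set \<Rightarrow> ('f \<Rightarrow> 'k skew_poly) \<Rightarrow>
   'a set \<Rightarrow> ('a \<Rightarrow> 'a) set set \<Rightarrow> ('f set \<Rightarrow> 'a set)" where
  "kummer_pairing v \<iota> A \<phi> X C =
     the_elem {kummer_pairing_rep v \<iota> A \<phi> \<xi> \<gamma> | \<xi> \<gamma>. \<xi> \<in> X \<and> \<gamma> \<in> \<Union>C}"

end

theory Submission
  imports Defs
begin

text \<open>
  The local Kummer pairing makes sense without any Drinfeld module. For an element \<open>f g\<^sup>-\<^sup>1\<close> of the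
  quotient ring \<open>D\<close> of \<open>R = k[\<tau>]\<close> choose \<open>y\<close> with \<open>g y = \<xi>\<close>; then \<open>[f g\<^sup>-\<^sup>1] \<mapsto> [f (\<gamma> y - y)]\<close> is an
  \<open>R\<close>-linear map \<open>D/R \<rightarrow> k\<^sup>a\<^sup>l\<^sup>g\<close> (\<open>kummer_map\<close>). Pulling it back along the map \<open>F/A \<rightarrow> D/R\<close>,
  \<open>b/a \<mapsto> \<phi>\<^sub>b \<phi>\<^sub>a\<^sup>-\<^sup>1\<close>, gives the pairing of \<open>\<phi>\<close>, and pulling it back along \<open>E/B \<rightarrow> D/R\<close> gives that of
  \<open>\<omega>\<close>. Since \<open>\<theta>\<close> compares two homomorphisms by way of \<open>Hom\<^sub>R(D/R, k\<^sup>a\<^sup>l\<^sup>g)\<close>, it takes one pairing to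
  the other.

  The map is well defined (\<open>kummer_value_well_defined\<close>) for three reasons. The Ore condition gives
  common denominators in \<open>D\<close> (\<open>skew_common_right_multiple\<close>). The nonzero elements of \<open>k\<close> are
  units, so all points that a nonzero skew polynomial sends to integral elements are integral
  (\<open>integral_if_ev_integral\<close>), and inertia acts trivially on the residues of such points. Finally,
  \<open>\<gamma> \<mapsto> \<gamma> y - y\<close> is a continuous homomorphism into a group that is abelian of exponent \<open>p\<close>, so it
  depends only on the class of \<open>\<gamma>\<close> in \<open>J\<^sub>K\<close> (\<open>J_group_class_defect\<close>).

  That \<open>\<theta>\<close> is well defined at the pairing amounts to uniqueness of adjoints. For it, every
  denominator \<open>g\<close> in \<open>R\<close> must divide some \<open>\<phi>\<^sub>a\<close>, which holds because \<open>R / g R\<close> is finite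
  (\<open>drinfeld_right_multiple\<close>). The pairing of \<open>\<phi>\<close> is defined on fractions \<open>b/a\<close>; that these exhaust
  \<open>F\<close> and that \<open>\<phi>\<close> is injective follows from the transcendence degree of \<open>F\<close>
  (\<open>two_variable_dependence\<close>) and from \<open>A\<close> being integrally closed (\<open>fraction_of_regular\<close>,
  \<open>drinfeld_injective\<close>).
\<close>


section \<open>Division in the skew polynomial ring\<close>

definition skew_degree :: "'k::zero skew_poly \<Rightarrow> nat" where
  "skew_degree f = Max {i. skew_coeff f i \<noteq> 0}"

lemma finite_skew_support: "finite {i. skew_coeff f i \<noteq> 0}"
  using skew_coeff[of f] by (simp add: eventually_cofinite)

lemma skew_coeff_degree_nonzero:
  assumes "f \<noteq> 0"
  shows "skew_coeff f (skew_degree f) \<noteq> 0"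
proof -
  have "{i. skew_coeff f i \<noteq> 0} \<noteq> {}"
    using assms skew_poly_eqI[of f 0] by (auto simp: zero_skew_poly.rep_eq)
  then show ?thesis
    using Max_in[OF finite_skew_support[of f]] by (simp add: skew_degree_def)
qed

lemma skew_coeff_above_degree: "i > skew_degree f \<Longrightarrow> skew_coeff f i = 0"
  using Max_ge[OF finite_skew_support[of f], of i] by (force simp: skew_degree_def)

lemma skew_degreeI:
  assumes "skew_coeff f n \<noteq> 0" "\<And>i. i > n \<Longrightarrow> skew_coeff f i = 0"
  shows "skew_degree f = n"
  unfolding skew_degree_def using assms
  by (intro Max_eqI finite_skew_support) (auto simp: not_less[symmetric])

text \<open>
  Twisting by a power of Frobenius does not create zeros, so the product of the top coefficients
  survives and degrees add as for ordinary polynomials.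
\<close>

lemma skew_coeff_mult_top:
  fixes f g :: "'k::field_prime_char skew_poly"
  assumes "\<And>i. i > m \<Longrightarrow> skew_coeff f i = 0" "\<And>i. i > n \<Longrightarrow> skew_coeff g i = 0"
  shows "skew_coeff (f * g) (m + n) = skew_coeff f m * skew_coeff g n ^ (CHAR('k) ^ m)"
    and "i > m + n \<Longrightarrow> skew_coeff (f * g) i = 0"
proof -
  have p: "CHAR('k) > 0"
    by (simp add: prime_CHAR_semidom prime_gt_0_nat)
  have z: "skew_coeff f l * skew_coeff g (i - l) ^ (CHAR('k) ^ l) = 0"
    if "l \<noteq> m" "l \<le> i" "i \<ge> m + n" for l i
  proof (cases "l > m")
    case False
    then have "i - l > n" using that by auto
    then show ?thesis using assms(2) p by simp
  qed (simp add: assms(1))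
  have "skew_coeff (f * g) (m + n) =
      (\<Sum>l=0..m+n. if l = m then skew_coeff f m * skew_coeff g n ^ (CHAR('k) ^ m) else 0)"
    unfolding times_skew_poly.rep_eq by (intro sum.cong) (auto simp: z)
  then show "skew_coeff (f * g) (m + n) = skew_coeff f m * skew_coeff g n ^ (CHAR('k) ^ m)"
    by simp
  assume i: "i > m + n"
  show "skew_coeff (f * g) i = 0"
    unfolding times_skew_poly.rep_eq
  proof (intro sum.neutral ballI)
    fix l assume "l \<in> {0..i}"
    then show "skew_coeff f l * skew_coeff g (i - l) ^ (CHAR('k) ^ l) = 0"
      using i z[of l i] assms(2)[of "i - l"] p by (cases "l = m") auto
  qed
qed

lemma skew_degree_mult:
  fixes f g :: "'k::field_prime_char skew_poly"
  assumes "f \<noteq> 0" "g \<noteq> 0"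
  shows "f * g \<noteq> 0" "skew_degree (f * g) = skew_degree f + skew_degree g"
proof -
  note top = skew_coeff_mult_top[OF skew_coeff_above_degree[where f = f] skew_coeff_above_degree[where f = g]]
  have "skew_coeff (f * g) (skew_degree f + skew_degree g) \<noteq> 0"
    using top(1) skew_coeff_degree_nonzero[OF assms(1)] skew_coeff_degree_nonzero[OF assms(2)]
    by simp
  then show "f * g \<noteq> 0" "skew_degree (f * g) = skew_degree f + skew_degree g"
    using top(2) by (auto intro!: skew_degreeI simp: zero_skew_poly.rep_eq)
qed

lemma skew_degree_power:
  fixes f :: "'k::field_prime_char skew_poly"
  assumes "f \<noteq> 0"
  shows "f ^ n \<noteq> 0 \<and> skew_degree (f ^ n) = n * skew_degree f"
proof (induction n)
  case 0
  have "skew_degree (1 :: 'k skew_poly) = 0"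
    by (rule skew_degreeI) (auto simp: one_skew_poly.rep_eq)
  then show ?case by simp
next
  case (Suc n)
  then show ?case using skew_degree_mult[OF assms, of "f ^ n"] by simp
qed

lemma skew_coeff_of_int_mult:
  fixes f :: "'k::field_prime_char skew_poly"
  shows "skew_coeff (of_int c * f) i = of_int c * skew_coeff f i"
proof (induction c rule: int_induct[of _ 0])
  case (step1 c)
  then show ?case by (simp add: distrib_right plus_skew_poly.rep_eq)
next
  case (step2 c)
  then show ?case by (simp add: left_diff_distrib minus_skew_poly.rep_eq)
qed (simp add: zero_skew_poly.rep_eq)

lemma skew_coeff_sum: "skew_coeff (\<Sum>i\<in>I. f i) n = (\<Sum>i\<in>I. skew_coeff (f i) n)"
  by (induction I rule: infinite_finite_induct)
    (auto simp: zero_skew_poly.rep_eq plus_skew_poly.rep_eq)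

text \<open>
  The powers of a skew polynomial of positive degree have distinct degrees, so no integer
  polynomial that survives modulo the characteristic annihilates it.
\<close>

lemma skew_powers_independent:
  fixes u :: "'k::field_prime_char skew_poly"
  assumes u0: "u \<noteq> 0" and u: "skew_degree u > 0"
    and c: "(\<Sum>i\<le>n. of_int (c i) * u ^ i) = 0" and i: "i \<le> n"
  shows "of_int (c i) = (0 :: 'k)"
proof (rule ccontr)
  assume "of_int (c i) \<noteq> (0 :: 'k)"
  let ?I = "{i. i \<le> n \<and> of_int (c i) \<noteq> (0 :: 'k)}"
  let ?m = "Max ?I"
  have "?m \<in> ?I"
    using i \<open>of_int (c i) \<noteq> (0 :: 'k)\<close> by (intro Max_in) auto
  have "skew_coeff (of_int (c l) * u ^ l) (?m * skew_degree u) = 0" if "l \<le> n" "l \<noteq> ?m" for l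
  proof (cases "of_int (c l) = (0 :: 'k)")
    case False
    then have "l \<le> ?m" using that by (intro Max_ge) auto
    then have "l * skew_degree u < ?m * skew_degree u" using that u by simp
    then show ?thesis
      using skew_coeff_above_degree[where f = "u ^ l"] skew_degree_power[OF u0, of l]
      by (simp add: skew_coeff_of_int_mult)
  qed (simp add: skew_coeff_of_int_mult)
  then have "skew_coeff (\<Sum>i\<le>n. of_int (c i) * u ^ i) (?m * skew_degree u) =
      (\<Sum>i\<le>n. if i = ?m then of_int (c ?m) * skew_coeff (u ^ ?m) (?m * skew_degree u) else 0)"
    unfolding skew_coeff_sum by (intro sum.cong) (auto simp: skew_coeff_of_int_mult)
  also have "\<dots> = of_int (c ?m) * skew_coeff (u ^ ?m) (?m * skew_degree u)"
    using \<open>?m \<in> ?I\<close> by simp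
  also have "\<dots> \<noteq> 0"
    using \<open>?m \<in> ?I\<close> skew_degree_power[OF u0, of ?m] skew_coeff_degree_nonzero[of "u ^ ?m"]
    by simp
  finally show False using c by (simp add: zero_skew_poly.rep_eq)
qed

lift_definition skew_monom :: "'k::field_prime_char \<Rightarrow> nat \<Rightarrow> 'k skew_poly"
  is "\<lambda>c m n. if n = m then c else 0"
  by (auto simp: eventually_cofinite intro: rev_finite_subset)

text \<open>
  A finite field is perfect. This is what makes division with the divisor on the left possible:
  there the unknown coefficient of the quotient appears under a power of Frobenius.
\<close>

lemma finite_field_char_root:
  fixes c :: "'k::finite_field"
  shows "\<exists>r. r ^ (CHAR('k) ^ n) = c"
proof -
  have p: "prime CHAR('k)"
    by (simp add: prime_CHAR_semidom)
  have "inj (\<lambda>r :: 'k. r ^ (CHAR('k) ^ n))"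
  proof (rule injI)
    fix x y :: 'k assume "x ^ (CHAR('k) ^ n) = y ^ (CHAR('k) ^ n)"
    moreover have "x ^ (CHAR('k) ^ n) = (x - y) ^ (CHAR('k) ^ n) + y ^ (CHAR('k) ^ n)"
      using freshmans_dream'[OF p refl, of "x - y" y] by simp
    ultimately show "x = y" by simp
  qed
  then show ?thesis
    by (metis finite_UNIV_inj_surj finite surjD)
qed

lemma skew_left_division:
  fixes f g :: "'k::finite_field skew_poly"
  assumes g: "g \<noteq> 0"
  shows "\<exists>q r. f = g * q + r \<and> (\<forall>i\<ge>skew_degree g. skew_coeff r i = 0)"
proof -
  let ?n = "skew_degree g"
  have "\<exists>q r. f = g * q + r \<and> (\<forall>i\<ge>?n. skew_coeff r i = 0)"
    if "\<And>i. i \<ge> ?n + m \<Longrightarrow> skew_coeff f i = 0" for m f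
    using that
  proof (induction m arbitrary: f)
    case 0
    then show ?case by (intro exI[of _ 0] exI[of _ f]) auto
  next
    case (Suc m)
    \<comment> \<open>the leading term of \<^term>\<open>g * skew_monom r m\<close> involves a Frobenius twist of \<^term>\<open>r\<close>\<close>
    obtain r where r: "r ^ (CHAR('k) ^ ?n) = skew_coeff f (?n + m) / skew_coeff g ?n"
      using finite_field_char_root by blast
    have top: "skew_coeff (skew_monom r m) i = 0" if "i > m" for i
      using that by (simp add: skew_monom.rep_eq)
    have "skew_coeff (f - g * skew_monom r m) i = 0" if "i \<ge> ?n + m" for i
    proof (cases "i = ?n + m")
      case True
      then show ?thesis
        using skew_coeff_mult_top(1)[OF skew_coeff_above_degree[where f = g] top]
          skew_coeff_degree_nonzero[OF g] r
        by (simp add: minus_skew_poly.rep_eq skew_monom.rep_eq)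
    next
      case False
      then show ?thesis
        using that Suc.prems[of i]
          skew_coeff_mult_top(2)[of ?n g m "skew_monom r m" i, OF skew_coeff_above_degree top]
        by (simp add: minus_skew_poly.rep_eq)
    qed
    then obtain q s where "f - g * skew_monom r m = g * q + s" "\<forall>i\<ge>?n. skew_coeff s i = 0"
      using Suc.IH by blast
    then have "f = g * (skew_monom r m + q) + s" by (simp add: algebra_simps)
    then show ?case using \<open>\<forall>i\<ge>?n. skew_coeff s i = 0\<close> by blast
  qed
  from this[of "Suc (skew_degree f)"] show ?thesis
    using skew_coeff_above_degree[where f = f] by fastforce
qed

lemma finite_skew_below: "finite {f :: 'k::finite_field skew_poly. \<forall>i\<ge>n. skew_coeff f i = 0}"
proof (rule inj_on_finite)
  show "inj_on skew_coeff {f :: 'k skew_poly. \<forall>i\<ge>n. skew_coeff f i = 0}"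
    by (simp add: inj_on_def skew_coeff_inject)
  show "finite {h :: nat \<Rightarrow> 'k. \<forall>x. (x \<in> {..<n} \<longrightarrow> h x \<in> UNIV) \<and> (x \<notin> {..<n} \<longrightarrow> h x = 0)}"
    by (intro finite_set_of_finite_funs) auto
qed auto

text \<open>
  Division by \<open>g\<close> leaves only finitely many remainders, because there are finitely many
  coefficients. So \<open>R / g R\<close> is finite, and among infinitely many elements two are congruent.
  Both the Ore condition and the passage to denominators \<open>\<phi>\<^sub>a\<close> rest on this.
\<close>

lemma skew_pigeonhole:
  fixes g :: "'k::finite_field skew_poly" and s :: "nat \<Rightarrow> 'k skew_poly"
  assumes g: "g \<noteq> 0"
  shows "\<exists>n m q. n < m \<and> s m - s n = g * q"
proof -
  have "\<forall>n. \<exists>q r. s n = g * q + r \<and> (\<forall>i\<ge>skew_degree g. skew_coeff r i = 0)"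
    using skew_left_division[OF g] by blast
  then obtain q r where qr: "\<And>n. s n = g * q n + r n"
    "\<And>n. \<forall>i\<ge>skew_degree g. skew_coeff (r n) i = 0"
    by metis
  have "\<not> inj r"
  proof
    assume "inj r"
    have "finite (range r)"
      by (rule finite_subset[OF _ finite_skew_below[of "skew_degree g"]]) (use qr in auto)
    with \<open>inj r\<close> show False using finite_imageD infinite_UNIV_nat by blast
  qed
  then obtain n m where "n < m" "r n = r m"
    by (auto simp: inj_def) (metis linorder_neqE_nat)
  then have "s m - s n = g * (q m - q n)" by (simp add: qr(1) algebra_simps)
  then show ?thesis using \<open>n < m\<close> by blast
qed

text \<open>
  The Ore condition, which puts two elements of \<open>D\<close> over a common denominator: the pigeonhole
  principle for the sequence \<open>h \<tau>\<^sup>n\<close> yields a nonzero multiple of \<open>h\<close> in \<open>g R\<close>.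
\<close>

lemma skew_common_right_multiple:
  fixes g h :: "'k::finite_field skew_poly"
  assumes "g \<noteq> 0" "h \<noteq> 0"
  shows "\<exists>a b. g * a = h * b \<and> g * a \<noteq> 0"
proof -
  obtain n m q where nm: "n < m" "h * tau ^ m - h * tau ^ n = g * q"
    using skew_pigeonhole[OF assms(1), of "\<lambda>n. h * tau ^ n"] by blast
  have tau: "(tau :: 'k skew_poly) \<noteq> 0" "skew_degree (tau :: 'k skew_poly) = 1"
    by (auto intro: skew_degreeI simp: tau.rep_eq zero_skew_poly.rep_eq
        dest!: arg_cong[of _ _ "\<lambda>f. skew_coeff f 1"])
  have "tau ^ m \<noteq> (tau ^ n :: 'k skew_poly)"
    using skew_degree_power[OF tau(1), of n] skew_degree_power[OF tau(1), of m] nm(1) tau(2)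
    by (metis less_irrefl mult.right_neutral)
  then have "h * (tau ^ m - tau ^ n) \<noteq> 0" using assms(2) by (intro skew_degree_mult) auto
  then show ?thesis using nm(2) by (metis right_diff_distrib)
qed


section \<open>Ring homomorphisms on subrings\<close>

lemma is_subringD:
  assumes "is_subring S"
  shows "0 \<in> S" "1 \<in> S" "x \<in> S \<Longrightarrow> y \<in> S \<Longrightarrow> x - y \<in> S" "x \<in> S \<Longrightarrow> - x \<in> S"
    "x \<in> S \<Longrightarrow> y \<in> S \<Longrightarrow> x + y \<in> S" "x \<in> S \<Longrightarrow> y \<in> S \<Longrightarrow> x * y \<in> S" "x \<in> S \<Longrightarrow> x ^ n \<in> S"
    "of_int c \<in> S"
proof -
  have S: "0 \<in> S" "1 \<in> S" "\<And>x y. x \<in> S \<Longrightarrow> y \<in> S \<Longrightarrow> x - y \<in> S"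
    "\<And>x y. x \<in> S \<Longrightarrow> y \<in> S \<Longrightarrow> x * y \<in> S"
    using assms by (auto simp: is_subring_def)
  have minus: "- x \<in> S" if "x \<in> S" for x using S(3)[OF S(1) that] by simp
  have add: "x + y \<in> S" if "x \<in> S" "y \<in> S" for x y using S(3)[OF that(1) minus[OF that(2)]] by simp
  show "0 \<in> S" "1 \<in> S" "x \<in> S \<Longrightarrow> y \<in> S \<Longrightarrow> x - y \<in> S" "x \<in> S \<Longrightarrow> - x \<in> S"
    "x \<in> S \<Longrightarrow> y \<in> S \<Longrightarrow> x + y \<in> S" "x \<in> S \<Longrightarrow> y \<in> S \<Longrightarrow> x * y \<in> S"
    using S minus add by auto
  show "x \<in> S \<Longrightarrow> x ^ n \<in> S" by (induction n) (use S in auto)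
  show "of_int c \<in> S"
    by (induction c rule: int_induct[of _ 0]) (use S add in auto)
qed

lemma subring_sum:
  assumes "is_subring S" "\<And>i. i \<in> I \<Longrightarrow> f i \<in> S"
  shows "sum f I \<in> S"
  using assms(2) by (induction I rule: infinite_finite_induct) (auto simp: is_subringD[OF assms(1)])

lemma ring_hom_on_eqs:
  assumes S: "is_subring S" and h: "ring_hom_on S h"
  shows "h 0 = 0" "h 1 = 1" "x \<in> S \<Longrightarrow> y \<in> S \<Longrightarrow> h (x + y) = h x + h y"
    "x \<in> S \<Longrightarrow> y \<in> S \<Longrightarrow> h (x * y) = h x * h y" "x \<in> S \<Longrightarrow> h (- x) = - h x"
    "x \<in> S \<Longrightarrow> y \<in> S \<Longrightarrow> h (x - y) = h x - h y" "x \<in> S \<Longrightarrow> h (x ^ n) = h x ^ n"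
    "h (of_int c) = of_int c"
proof -
  note mem = is_subringD[OF S]
  have H: "h 1 = 1" "\<And>x y. x \<in> S \<Longrightarrow> y \<in> S \<Longrightarrow> h (x + y) = h x + h y"
    "\<And>x y. x \<in> S \<Longrightarrow> y \<in> S \<Longrightarrow> h (x * y) = h x * h y"
    using h by (auto simp: ring_hom_on_def)
  have zero: "h 0 = 0" using H(2)[of 0 0] mem(1) by simp
  have minus: "h (- x) = - h x" if "x \<in> S" for x
    using H(2)[of x "- x"] that mem zero by (simp add: eq_neg_iff_add_eq_0 add.commute)
  have diff: "h (x - y) = h x - h y" if "x \<in> S" "y \<in> S" for x y
    using H(2)[of x "- y"] that mem minus by simp
  show "h 0 = 0" "h 1 = 1" "x \<in> S \<Longrightarrow> y \<in> S \<Longrightarrow> h (x + y) = h x + h y"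
    "x \<in> S \<Longrightarrow> y \<in> S \<Longrightarrow> h (x * y) = h x * h y" "x \<in> S \<Longrightarrow> h (- x) = - h x"
    "x \<in> S \<Longrightarrow> y \<in> S \<Longrightarrow> h (x - y) = h x - h y"
    using H zero minus diff by auto
  show "x \<in> S \<Longrightarrow> h (x ^ n) = h x ^ n"
    by (induction n) (use H mem in auto)
  show "h (of_int c) = of_int c"
    by (induction c rule: int_induct[of _ 0]) (use H zero diff mem in auto)
qed

lemma ring_hom_on_sum:
  assumes S: "is_subring S" and h: "ring_hom_on S h" and "\<And>i. i \<in> I \<Longrightarrow> f i \<in> S"
  shows "h (sum f I) = (\<Sum>i\<in>I. h (f i))"
  using assms(3)
  by (induction I rule: infinite_finite_induct)
    (auto simp: ring_hom_on_eqs[OF S h] subring_sum[OF S])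

lemma is_subring_UNIV: "is_subring UNIV"
  by (simp add: is_subring_def)


section \<open>Algebraic dependence in a global function field\<close>

text \<open>
  The combinations of the generators \<open>S\<close> with polynomial coefficients of bounded degree. The bound
  is strict and ignores the zero polynomial, so that \<open>D\<close> is the number of free coefficients.
\<close>

definition span_below ::
  "('p::field poly \<Rightarrow> 'f::field) \<Rightarrow> 'f set \<Rightarrow> nat \<Rightarrow> 'f set" where
  "span_below e S D = {\<Sum>s\<in>S. e (u s) * s | u. \<forall>s. u s \<noteq> 0 \<longrightarrow> degree (u s) < D}"

lemma span_belowI:
  assumes "x = (\<Sum>s\<in>S. e (u s) * s)" "\<And>s. u s \<noteq> 0 \<Longrightarrow> degree (u s) < D"
  shows "x \<in> span_below e S D"
  using assms unfolding span_below_def by blast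

lemma fract_embedding_hom:
  fixes h :: "'r::idom fract \<Rightarrow> 'f::ring_1"
  assumes "ring_hom_on UNIV h"
  shows "ring_hom_on UNIV (\<lambda>u. h (Fraction_Field.Fract u 1))"
proof -
  have frac: "Fraction_Field.Fract (x + y) 1 = Fraction_Field.Fract x 1 + Fraction_Field.Fract y 1"
    "Fraction_Field.Fract (x * y) 1 = Fraction_Field.Fract x 1 * Fraction_Field.Fract y 1"
    for x y :: 'r
    by simp_all
  show ?thesis
    unfolding ring_hom_on_def
  proof (intro conjI ballI)
    show "h (Fraction_Field.Fract 1 1) = 1"
      using ring_hom_on_eqs(2)[OF is_subring_UNIV assms] by (simp add: One_fract_def)
  qed (simp_all only: frac ring_hom_on_eqs[OF is_subring_UNIV assms] UNIV_I)
qed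

lemma card_span_below:
  fixes e :: "'p::finite_field poly \<Rightarrow> 'f::field"
  assumes "finite S"
  shows "finite (span_below e S D)" "card (span_below e S D) \<le> CARD('p) ^ (D * card S)"
proof -
  let ?P = "PiE (S \<times> {..<D}) (\<lambda>_. UNIV :: 'p set)"
  let ?u = "\<lambda>w s. \<Sum>i<D. monom (w (s, i)) i"
  have sub: "span_below e S D \<subseteq> (\<lambda>w. \<Sum>s\<in>S. e (?u w s) * s) ` ?P"
  proof
    fix x assume "x \<in> span_below e S D"
    then obtain u where u: "x = (\<Sum>s\<in>S. e (u s) * s)" "\<And>s. u s \<noteq> 0 \<Longrightarrow> degree (u s) < D"
      by (auto simp: span_below_def)
    let ?w = "restrict (\<lambda>(s, i). coeff (u s) i) (S \<times> {..<D})"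
    have "?u ?w s = u s" if "s \<in> S" for s
    proof (cases "u s = 0")
      case False
      have "coeff (?u ?w s) n = coeff (u s) n" for n
        using u(2)[OF False] that coeff_eq_0[of "u s" n]
        by (auto simp: coeff_sum coeff_monom)
      then show ?thesis by (rule poly_eqI)
    qed (use that in simp)
    then have "x = (\<Sum>s\<in>S. e (?u ?w s) * s)" using u(1) by (simp cong: sum.cong)
    moreover have "?w \<in> ?P" by auto
    ultimately show "x \<in> (\<lambda>w. \<Sum>s\<in>S. e (?u w s) * s) ` ?P" by blast
  qed
  have fin: "finite ?P" using assms by (intro finite_PiE) auto
  have "card ?P = CARD('p) ^ (D * card S)"
    using assms by (simp add: card_PiE card_cartesian_product mult.commute)
  then show "card (span_below e S D) \<le> CARD('p) ^ (D * card S)"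
    using surj_card_le[OF fin sub] by simp
  show "finite (span_below e S D)"
    using sub fin by (rule finite_surj[rotated])
qed

lemma span_below_mono: "D \<le> D' \<Longrightarrow> span_below e S D \<subseteq> span_below e S D'"
  by (auto simp: span_below_def) (metis order_less_le_trans)

lemma span_below_add:
  assumes e: "ring_hom_on UNIV e" and "x \<in> span_below e S D" "y \<in> span_below e S D"
  shows "x + y \<in> span_below e S D"
proof -
  note hom = ring_hom_on_eqs[OF is_subring_UNIV e]
  obtain u w where uw: "x = (\<Sum>s\<in>S. e (u s) * s)" "y = (\<Sum>s\<in>S. e (w s) * s)"
    "\<And>s. u s \<noteq> 0 \<Longrightarrow> degree (u s) < D" "\<And>s. w s \<noteq> 0 \<Longrightarrow> degree (w s) < D"
    using assms(2,3) by (auto simp: span_below_def)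
  have "x + y = (\<Sum>s\<in>S. e (u s + w s) * s)"
    by (simp add: uw hom sum.distrib distrib_right)
  moreover have "degree (u s + w s) < D" if "u s + w s \<noteq> 0" for s
  proof (cases "u s = 0 \<or> w s = 0")
    case True
    then show ?thesis using uw(3,4)[of s] that by auto
  next
    case False
    then show ?thesis using uw(3,4)[of s] by (auto intro: degree_add_less)
  qed
  ultimately show ?thesis by (rule span_belowI)
qed

lemma span_below_zero:
  assumes "ring_hom_on UNIV e"
  shows "0 \<in> span_below e S D"
  unfolding span_below_def using ring_hom_on_eqs(1)[OF is_subring_UNIV assms]
  by (auto intro!: exI[of _ "\<lambda>_. 0"])

lemma span_below_sum:
  assumes "ring_hom_on UNIV e" "\<And>i. i \<in> I \<Longrightarrow> f i \<in> span_below e S D"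
  shows "sum f I \<in> span_below e S D"
  using assms(2) by (induction I rule: infinite_finite_induct)
    (auto intro: span_below_add span_below_zero assms(1))

lemma span_below_of_nat_mult:
  assumes "ring_hom_on UNIV e" "x \<in> span_below e S D"
  shows "of_nat n * x \<in> span_below e S D"
  by (induction n) (auto intro: span_below_add span_below_zero assms simp: distrib_right)

text \<open>
  The bound grows only by the degree with which \<open>y\<close> acts on the generators. Iterating this, a
  product of \<open>n\<close> such factors raises the bound linearly in \<open>n\<close>, which is what the counting
  argument below needs.
\<close>

lemma span_below_mult:
  assumes e: "ring_hom_on UNIV e" and y: "\<And>s. s \<in> S \<Longrightarrow> y * s \<in> span_below e S (Suc D0)"
    and x: "x \<in> span_below e S D"
  shows "y * x \<in> span_below e S (D + D0)"
proof -
  note hom = ring_hom_on_eqs[OF is_subring_UNIV e]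
  obtain u where u: "x = (\<Sum>s\<in>S. e (u s) * s)" "\<And>s. u s \<noteq> 0 \<Longrightarrow> degree (u s) < D"
    using x by (auto simp: span_below_def)
  have "e (u s) * (y * s) \<in> span_below e S (D + D0)" if "s \<in> S" for s
  proof -
    obtain w where w: "y * s = (\<Sum>t\<in>S. e (w t) * t)" "\<And>t. w t \<noteq> 0 \<Longrightarrow> degree (w t) < Suc D0"
      using y[OF \<open>s \<in> S\<close>] by (auto simp: span_below_def)
    have "e (u s) * (y * s) = (\<Sum>t\<in>S. e (u s * w t) * t)"
      by (simp add: w hom sum_distrib_left mult.assoc)
    moreover have "degree (u s * w t) < D + D0" if "u s * w t \<noteq> 0" for t
      using that u(2)[of s] w(2)[of t] by (auto simp: degree_mult_eq)
    ultimately show ?thesis by (rule span_belowI)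
  qed
  then have "(\<Sum>s\<in>S. e (u s) * (y * s)) \<in> span_below e S (D + D0)"
    by (rule span_below_sum[OF e])
  then show ?thesis by (simp add: u(1) sum_distrib_left mult.left_commute)
qed

lemma span_below_power_mult:
  assumes "ring_hom_on UNIV e" "\<And>s. s \<in> S \<Longrightarrow> y * s \<in> span_below e S (Suc D0)"
    and x: "x \<in> span_below e S D"
  shows "y ^ n * x \<in> span_below e S (D + n * D0)"
proof (induction n)
  case (Suc n)
  show ?case using span_below_mult[OF assms(1,2) Suc.IH] by (simp add: ac_simps)
qed (use x in simp)

lemma common_denominator:
  fixes h :: "'p::field poly fract \<Rightarrow> 'f::field"
  assumes h: "ring_hom_on UNIV h" and S: "\<And>x. \<exists>c. x = (\<Sum>s\<in>S. h (c s) * s)"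
    and S_fin: "finite S" and T: "finite T"
  defines "e \<equiv> \<lambda>u. h (Fraction_Field.Fract u 1)"
  shows "\<exists>q D. q \<noteq> 0 \<and> (\<forall>y\<in>T. e q * y \<in> span_below e S (Suc D))"
proof -
  have e: "ring_hom_on UNIV e"
    unfolding e_def by (rule fract_embedding_hom[OF h])
  note hom = ring_hom_on_eqs[OF is_subring_UNIV e]
  have one: "\<exists>q D. q \<noteq> 0 \<and> e q * y \<in> span_below e S (Suc D)" for y
  proof -
    obtain c where c: "y = (\<Sum>s\<in>S. h (c s) * s)" using S by blast
    have "\<exists>a b. b \<noteq> 0 \<and> c s = Fraction_Field.Fract a b" for s by (cases "c s") auto
    then obtain a b where ab: "\<And>s. b s \<noteq> 0" "\<And>s. c s = Fraction_Field.Fract (a s) (b s)"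
      by metis
    define q where "q = prod b S"
    define u where "u s = a s * prod b (S - {s})" for s
    have "e q * h (c s) = e (u s)" if "s \<in> S" for s
    proof -
      have "q = b s * prod b (S - {s})" using that S_fin by (simp add: q_def prod.remove)
      then have "Fraction_Field.Fract q 1 * c s = Fraction_Field.Fract (u s) 1"
        using ab(1)[of s] by (simp add: ab(2) u_def eq_fract algebra_simps)
      then show ?thesis using h by (auto simp: ring_hom_on_def e_def) (metis)
    qed
    then have "e q * y = (\<Sum>s\<in>S. e (u s) * s)"
      by (simp add: c sum_distrib_left mult.assoc[symmetric])
    also have "\<dots> = (\<Sum>s\<in>S. e (if s \<in> S then u s else 0) * s)" by (rule sum.cong) auto
    also have "\<dots> \<in> span_below e S (Suc (Max (insert 0 (degree ` u ` S))))"
      using S_fin by (intro span_belowI[OF refl]) (auto simp: less_Suc_eq_le split: if_splits)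
    finally have "e q * y \<in> span_below e S (Suc (Max (insert 0 (degree ` u ` S))))" .
    moreover have "q \<noteq> 0" using ab(1) S_fin by (simp add: q_def)
    ultimately show ?thesis by blast
  qed
  show ?thesis
    using T
  proof induction
    case (insert y T)
    obtain q D where q: "q \<noteq> 0" "\<forall>y\<in>T. e q * y \<in> span_below e S (Suc D)"
      using insert.IH by blast
    obtain q' D' where q': "q' \<noteq> 0" "e q' * y \<in> span_below e S (Suc D')"
      using one by blast
    have const: "e r * x \<in> span_below e S (n + degree r)" if "x \<in> span_below e S n" for r x n
    proof -
      have "(\<Sum>t\<in>S. e (if t = s then r else 0) * t) = e r * s" if "s \<in> S" for s
      proof -
        have "(\<Sum>t\<in>S. e (if t = s then r else 0) * t) = (\<Sum>t\<in>S. if t = s then e r * s else 0)"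
          by (rule sum.cong) (auto simp: hom)
        then show ?thesis using S_fin that by simp
      qed
      then have "e r * s \<in> span_below e S (Suc (degree r))" if "s \<in> S" for s
        using that by (intro span_belowI[where u = "\<lambda>t. if t = s then r else 0"])
          (auto split: if_splits)
      then show ?thesis using span_below_mult[OF e _ that] by blast
    qed
    \<comment> \<open>each denominator enlarges the bound of the other one by its own degree\<close>
    let ?D = "D + D' + degree q + degree q'"
    have mono: "span_below e S (Suc D + degree q') \<subseteq> span_below e S (Suc ?D)"
      "span_below e S (Suc D' + degree q) \<subseteq> span_below e S (Suc ?D)"
      by (auto intro!: span_below_mono)
    have "e (q' * q) * z \<in> span_below e S (Suc ?D)" if "z \<in> insert y T" for z
    proof (cases "z = y")
      case True
      then show ?thesis
        using const[OF q'(2), of q] mono(2) by (auto simp: hom mult_ac)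
    next
      case False
      then show ?thesis
        using that const[OF bspec[OF q(2), of z], of q'] mono(1) by (auto simp: hom mult_ac)
    qed
    then show ?case using q(1) q'(1) by (metis mult_eq_0_iff)
  qed (auto intro: exI[of _ 1])
qed

text \<open>
  A global function field has transcendence degree at most one, proved by counting. After
  multiplication with one fixed power of a common denominator, the monomials \<open>a\<^sup>i x\<^sup>j\<close> with
  \<open>i, j \<le> N\<close> lie in a set whose cardinality is exponential in a linear function of \<open>N\<close>,
  while there are exponentially many in \<open>(N + 1)\<^sup>2\<close> combinations of them with coefficients below
  \<open>p\<close>. For large \<open>N\<close> two combinations agree, and their difference is the dependence.
\<close>

lemma two_variable_dependence:
  fixes a x :: "'f::field"
  assumes p: "CARD('p::finite_field) = p" and F: "global_function_field TYPE('p) TYPE('f)"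
  shows "\<exists>N c. (\<exists>i\<le>N. \<exists>j\<le>N. \<not> int p dvd c i j) \<and>
    (\<Sum>j\<le>N. (\<Sum>i\<le>N. of_int (c i j) * a ^ i) * x ^ j) = 0"
proof -
  obtain h :: "'p poly fract \<Rightarrow> 'f" and S where h: "ring_hom_on UNIV h" and S_fin: "finite S"
    and S: "\<And>x. \<exists>c. x = (\<Sum>s\<in>S. h (c s) * s)"
    using F by (auto simp: global_function_field_def)
  define e where "e = (\<lambda>u. h (Fraction_Field.Fract u 1))"
  have e: "ring_hom_on UNIV e"
    unfolding e_def by (rule fract_embedding_hom[OF h])
  note hom = ring_hom_on_eqs[OF is_subring_UNIV e]
  let ?T = "insert 1 (S \<union> (\<lambda>s. a * s) ` S \<union> (\<lambda>s. x * s) ` S)"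
  have "\<exists>q D. q \<noteq> 0 \<and> (\<forall>y\<in>?T. e q * y \<in> span_below e S (Suc D))"
    unfolding e_def by (rule common_denominator[OF h S S_fin]) (use S_fin in simp)
  then obtain q D where q: "q \<noteq> 0" and qT: "\<And>y. y \<in> ?T \<Longrightarrow> e q * y \<in> span_below e S (Suc D)"
    by blast
  have "e q \<noteq> 0"
  proof
    assume "e q = 0"
    then have "h (Fraction_Field.Fract q 1 * Fraction_Field.Fract 1 q) = 0"
      using h unfolding ring_hom_on_def e_def by (metis UNIV_I mult_zero_left)
    moreover have "Fraction_Field.Fract q 1 * Fraction_Field.Fract 1 q = 1"
      using q by (simp add: One_fract_def eq_fract)
    ultimately show False using h by (simp add: ring_hom_on_def)
  qed
  \<comment> \<open>chosen so that the bound \<open>Suc (2 * N + 1) * Suc D * card S\<close> equals \<open>Suc N * N\<close>\<close>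
  define N where "N = 2 * Suc D * card S"
  have step: "e q * s \<in> span_below e S (Suc D)" "(e q * a) * s \<in> span_below e S (Suc D)"
    "(e q * x) * s \<in> span_below e S (Suc D)" if "s \<in> S" for s
    using qT[of s] qT[of "a * s"] qT[of "x * s"] that by (auto simp: mult.assoc)
  \<comment> \<open>the same power of the denominator for all monomials: unused factors are supplied by \<^term>\<open>e q\<close>\<close>
  have monomial: "e q ^ (2 * N + 1) * (a ^ i * x ^ j) \<in> span_below e S (Suc (2 * N + 1) * Suc D)"
    if "i \<le> N" "j \<le> N" for i j
  proof -
    have "e q * 1 \<in> span_below e S (Suc D)" using qT by blast
    then have "e q ^ (2 * N - i - j) * (e q * 1) \<in> span_below e S (Suc D + (2 * N - i - j) * D)"
      by (elim span_below_power_mult[OF e step(1), rotated])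
    then have "(e q * a) ^ i * (e q ^ (2 * N - i - j) * (e q * 1))
        \<in> span_below e S (Suc D + (2 * N - i - j) * D + i * D)"
      by (elim span_below_power_mult[OF e step(2), rotated])
    then have "(e q * x) ^ j * ((e q * a) ^ i * (e q ^ (2 * N - i - j) * (e q * 1)))
        \<in> span_below e S (Suc D + (2 * N - i - j) * D + i * D + j * D)"
      by (elim span_below_power_mult[OF e step(3), rotated])
    moreover have "(e q * x) ^ j * ((e q * a) ^ i * (e q ^ (2 * N - i - j) * (e q * 1))) =
        e q ^ (j + i + (2 * N - i - j) + 1) * (a ^ i * x ^ j)"
      by (simp add: power_mult_distrib power_add)
    moreover have "j + i + (2 * N - i - j) + 1 = 2 * N + 1" using that by simp
    moreover have "Suc D + (2 * N - i - j) * D + i * D + j * D = Suc D + 2 * N * D"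
    proof -
      have "(2 * N - i - j) * D + i * D + j * D = (2 * N - i - j + i + j) * D"
        by (simp add: algebra_simps)
      then show ?thesis using that by simp
    qed
    moreover have "span_below e S (Suc D + 2 * N * D) \<subseteq> span_below e S (Suc (2 * N + 1) * Suc D)"
      by (intro span_below_mono) simp
    ultimately show ?thesis by (simp only: subset_iff)
  qed
  let ?C = "PiE ({..N} \<times> {..N}) (\<lambda>_. {..<p})"
  define M where "M = e q ^ (2 * N + 1)"
  define \<Phi> where "\<Phi> c = (\<Sum>j\<le>N. \<Sum>i\<le>N. of_nat (c (i, j)) * (M * (a ^ i * x ^ j)))"
    for c :: "nat \<times> nat \<Rightarrow> nat"
  have "card {0, 1 :: 'p} \<le> CARD('p)" by (intro card_mono) auto
  then have "p > 1" using p by simp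
  have "\<not> inj_on \<Phi> ?C"
  proof
    assume inj: "inj_on \<Phi> ?C"
    have sub: "\<Phi> ` ?C \<subseteq> span_below e S (Suc (2 * N + 1) * Suc D)"
      unfolding \<Phi>_def M_def
      by (intro image_subsetI span_below_sum[OF e] span_below_of_nat_mult[OF e] monomial) auto
    have "card ?C \<le> card (span_below e S (Suc (2 * N + 1) * Suc D))"
      by (rule card_inj_on_le[OF inj sub card_span_below(1)[OF S_fin]])
    also have "\<dots> \<le> p ^ (Suc (2 * N + 1) * Suc D * card S)"
      using card_span_below(2)[OF S_fin, of e] p by blast
    finally have "card ?C \<le> p ^ (Suc (2 * N + 1) * Suc D * card S)" .
    moreover have "card ?C = p ^ (Suc N * Suc N)"
      by (simp add: card_PiE card_cartesian_product)
    ultimately have "Suc N * Suc N \<le> Suc (2 * N + 1) * Suc D * card S"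
      using power_le_imp_le_exp[OF \<open>p > 1\<close>] by simp
    also have "Suc (2 * N + 1) * Suc D * card S = Suc N * N" by (simp add: N_def algebra_simps)
    finally show False by simp
  qed
  then obtain c c' where cc: "c \<in> ?C" "c' \<in> ?C" "c \<noteq> c'" "\<Phi> c = \<Phi> c'"
    unfolding inj_on_def by blast
  define d where "d i j = int (c (i, j)) - int (c' (i, j))" for i j
  obtain i j where ij: "i \<le> N" "j \<le> N" "c (i, j) \<noteq> c' (i, j)"
    using cc(3) PiE_ext[OF cc(1,2)] by auto
  have "c (i, j) < p" "c' (i, j) < p" using cc(1,2) ij(1,2) by (auto dest: PiE_mem)
  then have "\<not> int p dvd d i j"
    using ij(3) dvd_imp_le_int[of "d i j" "int p"] by (auto simp: d_def)
  moreover have "(\<Sum>j\<le>N. (\<Sum>i\<le>N. of_int (d i j) * a ^ i) * x ^ j) = 0"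
  proof -
    have "0 = \<Phi> c - \<Phi> c'" using cc(4) by simp
    also have "\<dots> = (\<Sum>j\<le>N. \<Sum>i\<le>N. of_int (d i j) * (M * (a ^ i * x ^ j)))"
      by (simp add: \<Phi>_def d_def sum_subtractf left_diff_distrib)
    also have "\<dots> = M * (\<Sum>j\<le>N. (\<Sum>i\<le>N. of_int (d i j) * a ^ i) * x ^ j)"
      by (simp add: sum_distrib_left sum_distrib_right mult_ac)
    finally show ?thesis using \<open>e q \<noteq> 0\<close> by (simp add: M_def)
  qed
  ultimately show ?thesis using ij(1,2) by blast
qed


section \<open>Drinfeld modules on the ring of functions regular outside a place\<close>

lemma of_nat_card_UNIV_eq_0: "of_nat CARD('p) = (0 :: 'p::{finite, ring_1})"
proof -
  have "(\<Sum>x\<in>UNIV. x + 1) = (\<Sum>x\<in>UNIV. x :: 'p)"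
    by (rule sum.reindex_bij_betw, rule bij_betwI[of _ _ _ "\<lambda>x. x - 1"]) auto
  then show ?thesis by (simp add: sum.distrib)
qed

lemma drinfeld_positive_degree:
  assumes "drinfeld_module A \<phi>"
  obtains a where "a \<in> A" "\<phi> a \<noteq> 0" "skew_degree (\<phi> a) > 0"
proof -
  obtain a i where a: "a \<in> A" "i > 0" "skew_coeff (\<phi> a) i \<noteq> 0"
    using assms by (auto simp: drinfeld_module_def)
  then have "skew_degree (\<phi> a) > 0"
    using skew_coeff_above_degree[where f = "\<phi> a" and i = i] by (cases "skew_degree (\<phi> a)") auto
  moreover have "\<phi> a \<noteq> 0" using a(3) by (auto simp: zero_skew_poly.rep_eq)
  ultimately show thesis using a(1) that by blast
qed

text \<open>
  Choose \<open>a\<close> with \<open>\<phi>\<^sub>a\<close> of positive degree. A polynomial expression in \<open>a\<close> whose coefficients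
  do not all vanish modulo \<open>p\<close> is not even killed by \<open>\<phi>\<close>, since the powers of \<open>\<phi>\<^sub>a\<close> are
  independent. So an algebraic dependence of \<open>x\<close> and \<open>a\<close> can be read as an equation for \<open>x\<close>
  over \<open>A\<close> all of whose nonzero coefficients have nonzero image under \<open>\<phi>\<close>.
\<close>

lemma drinfeld_algebraic_relation:
  fixes A :: "'f::field set" and \<phi> :: "'f \<Rightarrow> 'k::field_prime_char skew_poly" and x :: 'f
  assumes p: "CARD('p::finite_field) = p" "CHAR('k) = p"
    and F: "global_function_field TYPE('p) TYPE('f)"
    and A: "is_subring A" and \<phi>: "drinfeld_module A \<phi>"
  shows "\<exists>(N :: nat) b. (\<forall>j. b j \<in> A) \<and> (\<forall>j. b j \<noteq> 0 \<longrightarrow> \<phi> (b j) \<noteq> 0) \<and>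
    (\<exists>j\<le>N. b j \<noteq> 0) \<and> (\<Sum>j\<le>N. b j * x ^ j) = 0"
proof -
  have hom: "ring_hom_on A \<phi>" using \<phi> by (simp add: drinfeld_module_def)
  note mem = is_subringD[OF A] and eqs = ring_hom_on_eqs[OF A hom]
  obtain a where a: "a \<in> A" "\<phi> a \<noteq> 0" "skew_degree (\<phi> a) > 0"
    using drinfeld_positive_degree[OF \<phi>] by blast
  obtain N c where c: "\<exists>i\<le>N. \<exists>j\<le>N. \<not> int p dvd c i j"
    "(\<Sum>j\<le>N. (\<Sum>i\<le>N. of_int (c i j) * a ^ i) * x ^ j) = 0"
    using two_variable_dependence[OF p(1) F, of a x] by blast
  define b where "b j = (\<Sum>i\<le>N. of_int (c i j) * a ^ i)" for j
  obtain h :: "'p poly fract \<Rightarrow> 'f" where h: "ring_hom_on UNIV h"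
    using F by (auto simp: global_function_field_def)
  have p0: "of_nat p = (0 :: 'f)"
  proof -
    have "of_nat p = (0 :: 'p)" using of_nat_card_UNIV_eq_0[where 'p = 'p] p(1) by simp
    then have "of_nat p = (0 :: 'p poly fract)"
      by (simp add: of_nat_fract of_nat_poly Zero_fract_def)
    then show ?thesis
      using ring_hom_on_eqs(1)[OF is_subring_UNIV h]
        ring_hom_on_eqs(8)[OF is_subring_UNIV h, of "int p"] by simp
  qed
  have indep: "\<phi> (b j) \<noteq> 0" if "\<exists>i\<le>N. \<not> int p dvd c i j" for j
  proof
    assume "\<phi> (b j) = 0"
    moreover have "\<phi> (b j) = (\<Sum>i\<le>N. of_int (c i j) * \<phi> a ^ i)"
      unfolding b_def by (subst ring_hom_on_sum[OF A hom]) (simp_all add: mem eqs a)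
    ultimately have "of_int (c i j) = (0 :: 'k)" if "i \<le> N" for i
      using skew_powers_independent[OF a(2,3) _ that] by metis
    then show False using that p(2) of_int_eq_0_iff_char_dvd[where 'a = 'k] by blast
  qed
  have "\<phi> (b j) \<noteq> 0" if "b j \<noteq> 0" for j
  proof (rule indep, rule ccontr)
    assume "\<not> (\<exists>i\<le>N. \<not> int p dvd c i j)"
    then have "of_int (c i j) = (0 :: 'f)" if "i \<le> N" for i
      using that p0 by (fastforce elim!: dvdE)
    then show False using that by (simp add: b_def)
  qed
  moreover have "\<exists>j\<le>N. b j \<noteq> 0" using c(1) indep eqs(1) by metis
  moreover have "b j \<in> A" for j unfolding b_def by (intro subring_sum[OF A] mem a)
  moreover have "(\<Sum>j\<le>N. b j * x ^ j) = 0" unfolding b_def by (rule c(2))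
  ultimately show ?thesis by blast
qed

text \<open>
  Dividing an algebraic equation of \<open>x\<close> by a power of \<open>x\<close> makes its constant coefficient nonzero;
  that coefficient is then a multiple of \<open>x\<close> whose image under \<open>\<phi>\<close> is nonzero, so \<open>\<phi>\<^sub>x\<close>
  cannot vanish.
\<close>

lemma drinfeld_injective:
  fixes A :: "'f::field set" and \<phi> :: "'f \<Rightarrow> 'k::field_prime_char skew_poly"
  assumes p: "CARD('p::finite_field) = p" "CHAR('k) = p"
    and F: "global_function_field TYPE('p) TYPE('f)"
    and A: "is_subring A" and \<phi>: "drinfeld_module A \<phi>" and x: "x \<in> A" "x \<noteq> 0"
  shows "\<phi> x \<noteq> 0"
proof
  assume zero: "\<phi> x = 0"
  have hom: "ring_hom_on A \<phi>" using \<phi> by (simp add: drinfeld_module_def)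
  note mem = is_subringD[OF A] and eqs = ring_hom_on_eqs[OF A hom]
  obtain N b where b: "\<And>j. b j \<in> A" "\<exists>j\<le>N. b j \<noteq> 0"
    "\<And>j. b j \<noteq> 0 \<Longrightarrow> \<phi> (b j) \<noteq> 0" "(\<Sum>j\<le>N. b j * x ^ j) = 0"
    using drinfeld_algebraic_relation[OF p F A \<phi>, of x] by blast
  define m where "m = (LEAST j. b j \<noteq> 0)"
  obtain j0 where j0: "j0 \<le> N" "b j0 \<noteq> 0" using b(2) by blast
  have m: "b m \<noteq> 0" "m \<le> j0" "\<And>j. j < m \<Longrightarrow> b j = 0"
    unfolding m_def using j0(2) by (rule LeastI, rule Least_le) (use not_less_Least in blast)
  then have "m \<le> N" using j0(1) by simp
  have "(\<Sum>j\<le>N. b j * x ^ j) = (\<Sum>j\<in>{m..N}. b j * x ^ j)"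
    by (rule sum.mono_neutral_right) (auto simp: m(3) not_le)
  also have "\<dots> = (\<Sum>j\<in>{m..N}. x ^ m * (b j * x ^ (j - m)))"
    by (rule sum.cong) (auto simp: power_add[symmetric] mult_ac)
  also have "\<dots> = x ^ m * (b m + (\<Sum>j\<in>{m<..N}. b j * x ^ (j - m)))"
    using \<open>m \<le> N\<close> by (simp add: sum_distrib_left[symmetric] sum.head)
  finally have "b m + (\<Sum>j\<in>{m<..N}. b j * x ^ (j - m)) = 0" using b(4) x(2) by simp
  then have "b m = - (\<Sum>j\<in>{m<..N}. b j * x ^ (j - m))" by (simp add: eq_neg_iff_add_eq_0)
  also have "(\<Sum>j\<in>{m<..N}. b j * x ^ (j - m)) = (\<Sum>j\<in>{m<..N}. b j * x ^ (j - m - 1)) * x"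
    unfolding sum_distrib_right
    by (rule sum.cong) (auto simp: mult.assoc power_Suc2[symmetric] Suc_diff_Suc simp del: power_Suc)
  also have "\<phi> (- (\<dots>)) = 0"
    using zero x(1) b(1) by (simp add: eqs mem subring_sum[OF A])
  finally show False using b(3)[OF m(1)] by simp
qed

text \<open>
  The usual proof that a valuation ring is integrally closed, for the element \<open>b\<^sub>n x\<close>: if it
  were outside \<open>V\<close>, then \<open>1/x\<close> would be in \<open>V\<close>, and the equation divided by \<open>x\<^sup>n\<^sup>-\<^sup>1\<close> would
  express \<open>b\<^sub>n x\<close> through elements of \<open>V\<close>.
\<close>

lemma place_integral:
  fixes V :: "'f::field set"
  assumes V: "is_subring V" "\<And>y. y \<in> V \<or> inverse y \<in> V"
    and b: "\<And>j. b j \<in> V" "(\<Sum>j\<le>n. b j * x ^ j) = 0" and n: "n > 0"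
  shows "b n * x \<in> V"
proof (rule ccontr)
  assume out: "b n * x \<notin> V"
  note mem = is_subringD[OF V(1)]
  have x: "x \<noteq> 0" "b n \<noteq> 0" using out mem(1) by auto
  have inv: "inverse x \<in> V"
    using V(2)[of "b n * x"] out mem(6)[OF b(1)[of n], of "inverse (b n * x)"] x by (simp add: field_simps)
  have "inverse x ^ (n - 1) * (\<Sum>j\<le>n. b j * x ^ j) = 0" by (simp add: b(2))
  also have "{..n} = insert n {..<n}" by auto
  finally have "inverse x ^ (n - 1) * (b n * x ^ n) + inverse x ^ (n - 1) * (\<Sum>j<n. b j * x ^ j) = 0"
    by (simp add: distrib_left)
  moreover have "inverse x ^ (n - 1) * (b n * x ^ n) = b n * x"
    using n x by (cases n) (simp_all add: field_simps)
  moreover have "inverse x ^ (n - 1) * (\<Sum>j<n. b j * x ^ j) = (\<Sum>j<n. b j * inverse x ^ (n - 1 - j))"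
    unfolding sum_distrib_left
  proof (rule sum.cong)
    fix j assume "j \<in> {..<n}"
    then have "inverse x ^ (n - 1) = inverse x ^ (n - 1 - j) * inverse x ^ j"
      by (simp add: power_add[symmetric])
    then show "inverse x ^ (n - 1) * (b j * x ^ j) = b j * inverse x ^ (n - 1 - j)"
      using x by (simp add: field_simps)
  qed simp
  ultimately have "b n * x + (\<Sum>j<n. b j * inverse x ^ (n - 1 - j)) = 0"
    by (simp only:)
  then have "b n * x = - (\<Sum>j<n. b j * inverse x ^ (n - 1 - j))"
    by (simp only: eq_neg_iff_add_eq_0)
  moreover have "\<dots> \<in> V" by (intro mem subring_sum[OF V(1)] b inv)
  ultimately show False using out by simp
qed

lemma is_subring_regular_outside: "is_subring (regular_outside infty)"
proof -
  have "is_subring V" if "V \<in> places" for V :: "'a set" using that by (simp add: places_def)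
  then show ?thesis
    unfolding is_subring_def[of "regular_outside infty"]
    by (simp add: regular_outside_def is_subringD)
qed

text \<open>
  The element \<open>x\<close> is algebraic over \<open>A\<close>, and \<open>A\<close> is an intersection of integrally closed rings,
  so the leading coefficient of an equation for \<open>x\<close> is a denominator.
\<close>

lemma fraction_of_regular:
  fixes \<phi> :: "'f::field \<Rightarrow> 'k::field_prime_char skew_poly" and infty :: "'f set"
  assumes p: "CARD('p::finite_field) = p" "CHAR('k) = p"
    and F: "global_function_field TYPE('p) TYPE('f)"
    and \<phi>: "drinfeld_module (regular_outside infty) \<phi>"
  shows "\<exists>a\<in>regular_outside infty. \<exists>b\<in>regular_outside infty. a \<noteq> 0 \<and> x = b / a"
proof -
  let ?A = "regular_outside infty"
  obtain N b where b: "\<And>j. b j \<in> ?A" "\<exists>j\<le>N. b j \<noteq> 0" "(\<Sum>j\<le>N. b j * x ^ j) = 0"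
    using drinfeld_algebraic_relation[OF p F is_subring_regular_outside \<phi>, of x] by blast
  define n where "n = Max {j. j \<le> N \<and> b j \<noteq> 0}"
  have "n \<in> {j. j \<le> N \<and> b j \<noteq> 0}" unfolding n_def using b(2) by (intro Max_in) auto
  then have n: "n \<le> N" "b n \<noteq> 0" by auto
  have "b j = 0" if "n < j" "j \<le> N" for j
  proof (rule ccontr)
    assume "b j \<noteq> 0"
    then have "j \<le> n" unfolding n_def using that(2) by (intro Max_ge) auto
    then show False using that(1) by simp
  qed
  then have "(\<Sum>j\<le>N. b j * x ^ j) = (\<Sum>j\<le>n. b j * x ^ j)"
    using n(1) by (intro sum.mono_neutral_right) auto
  then have sum: "(\<Sum>j\<le>n. b j * x ^ j) = 0" using b(3) by simp
  have "n > 0" using sum n(2) by (cases n) auto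
  have "b n * x \<in> V" if V: "V \<in> places - {infty}" for V
  proof (rule place_integral[OF _ _ _ sum \<open>n > 0\<close>])
    show "is_subring V" "y \<in> V \<or> inverse y \<in> V" for y using V by (auto simp: places_def)
    show "b j \<in> V" for j using b(1)[of j] V by (auto simp: regular_outside_def)
  qed
  then have "b n * x \<in> ?A" by (simp add: regular_outside_def)
  moreover have "x = b n * x / b n" using n(2) by simp
  ultimately show ?thesis using b(1)[of n] n(2) by blast
qed

text \<open>
  The rational function field is itself a global function field, so the injectivity of Drinfeld
  modules covers \<open>\<omega>\<close> as well.
\<close>

lemma global_function_field_poly_fract:
  "global_function_field TYPE('p::finite_field) TYPE('p poly fract)"
proof -
  have "\<exists>c. x = (\<Sum>s\<in>{1}. c s * s)" for x :: "'p poly fract"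
    by (rule exI[of _ "\<lambda>_. x"]) simp
  then show ?thesis
    unfolding global_function_field_def
    by (intro exI[of _ "\<lambda>x. x"] exI[of _ "{1}"]) (simp add: ring_hom_on_def)
qed

lemma is_subring_poly_subring: "is_subring poly_subring"
proof -
  have eqs: "Fraction_Field.Fract b 1 - Fraction_Field.Fract c 1 = Fraction_Field.Fract (b - c) 1"
    "Fraction_Field.Fract b 1 * Fraction_Field.Fract c 1 = Fraction_Field.Fract (b * c) 1"
    for b c :: "'a poly" by simp_all
  show ?thesis
    unfolding is_subring_def poly_subring_def
  proof (intro conjI ballI)
    show "0 \<in> range (\<lambda>b :: 'a poly. Fraction_Field.Fract b 1)"
      "1 \<in> range (\<lambda>b :: 'a poly. Fraction_Field.Fract b 1)"
      unfolding Zero_fract_def One_fract_def by (rule rangeI)+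
  qed (auto simp only: eqs intro: rangeI)
qed

lemma fraction_of_poly_subring: "\<exists>a\<in>poly_subring. \<exists>b\<in>poly_subring. a \<noteq> 0 \<and> x = b / a"
proof (cases x)
  case (Fract b a)
  have "Fraction_Field.Fract a 1 \<in> poly_subring" "Fraction_Field.Fract b 1 \<in> poly_subring"
    by (simp_all add: poly_subring_def)
  moreover have "Fraction_Field.Fract a 1 \<noteq> 0" using Fract by (simp add: Zero_fract_def eq_fract)
  moreover have "x = Fraction_Field.Fract b 1 / Fraction_Field.Fract a 1" using Fract by simp
  ultimately show ?thesis by blast
qed

text \<open>
  Surjectivity of \<open>R \<otimes>\<^sub>A F \<rightarrow> D\<close> in elementary terms: every denominator \<open>g\<close> is a left
  divisor of some nonzero \<open>\<phi>\<^sub>a\<close>. Two powers of an element \<open>\<phi>\<^sub>a\<close> of positive degree are congruent modulo \<open>g R\<close>, and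
  they differ because their degrees do.
\<close>

lemma drinfeld_right_multiple:
  fixes g :: "'k::finite_field skew_poly"
  assumes \<phi>: "drinfeld_module A \<phi>" and A: "is_subring A" and g: "g \<noteq> 0"
  shows "\<exists>a\<in>A. \<exists>q. \<phi> a \<noteq> 0 \<and> \<phi> a = g * q"
proof -
  have hom: "ring_hom_on A \<phi>" using \<phi> by (simp add: drinfeld_module_def)
  note mem = is_subringD[OF A] and eqs = ring_hom_on_eqs[OF A hom]
  obtain a where a: "a \<in> A" "\<phi> a \<noteq> 0" "skew_degree (\<phi> a) > 0"
    using drinfeld_positive_degree[OF \<phi>] by blast
  obtain n m q where nm: "n < m" "\<phi> a ^ m - \<phi> a ^ n = g * q"
    using skew_pigeonhole[OF g, of "\<lambda>n. \<phi> a ^ n"] by blast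
  have "\<phi> a ^ m \<noteq> \<phi> a ^ n"
    using skew_degree_power[OF a(2)] nm(1) a(3) by (metis less_irrefl mult_less_cancel2)
  moreover have "a ^ m - a ^ n \<in> A" using a(1) by (intro mem)
  moreover have "\<phi> (a ^ m - a ^ n) = \<phi> a ^ m - \<phi> a ^ n"
    using a(1) mem(7)[OF a(1)] by (simp add: eqs(6,7))
  ultimately show ?thesis using nm(2) by (metis right_minus_eq)
qed


section \<open>Skew polynomials acting on a valued field\<close>

lemma nonarch_absolute_valueD:
  assumes "nonarch_absolute_value v"
  shows "v x \<ge> 0" "v x = 0 \<longleftrightarrow> x = 0" "v (x * y) = v x * v y" "v (x + y) \<le> max (v x) (v y)"
    "v 0 = 0" "v 1 = 1" "v (- x) = v x" "v (x - y) \<le> max (v x) (v y)" "v (x ^ n) = v x ^ n"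
    "v (inverse x) = inverse (v x)"
proof -
  have nn: "v x \<ge> 0" and zero: "v x = 0 \<longleftrightarrow> x = 0" and mult: "v (x * y) = v x * v y"
    and add: "v (x + y) \<le> max (v x) (v y)" for x y
    using assms by (auto simp: nonarch_absolute_value_def)
  have "v 1 * v 1 = v 1" using mult[of 1 1] by simp
  then have one: "v 1 = 1" using zero[of 1] by simp
  have "v (- 1) * v (- 1) = 1" using mult[of "- 1" "- 1"] one by simp
  then have "v (- 1) = 1" using nn[of "- 1"] by (simp add: square_eq_1_iff)
  then have minus: "v (- x) = v x" for x using mult[of "- 1" x] by simp
  show "v x \<ge> 0" "v x = 0 \<longleftrightarrow> x = 0" "v (x * y) = v x * v y" "v (x + y) \<le> max (v x) (v y)"
    "v 0 = 0" "v 1 = 1" "v (- x) = v x"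
    using nn zero mult add one minus by auto
  show "v (x - y) \<le> max (v x) (v y)" using add[of x "- y"] minus[of y] by simp
  show "v (x ^ n) = v x ^ n" by (induction n) (simp_all add: one mult)
  show "v (inverse x) = inverse (v x)"
  proof (cases "x = 0")
    case False
    then have "v x * v (inverse x) = 1" using mult[of x "inverse x"] one by simp
    then show ?thesis by (simp add: inverse_unique)
  qed (use zero[of 0] in simp)
qed

lemma nonarch_sum_le:
  assumes "nonarch_absolute_value v" "\<And>i. i \<in> I \<Longrightarrow> v (f i) \<le> B" "B \<ge> 0"
  shows "v (sum f I) \<le> B"
  using assms(2)
proof (induction I rule: infinite_finite_induct)
  case (insert i I)
  have "v (f i + sum f I) \<le> max (v (f i)) (v (sum f I))"
    by (rule nonarch_absolute_valueD(4)[OF assms(1)])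
  also have "\<dots> \<le> B" using insert by simp
  finally show ?case using insert.hyps by simp
qed (use nonarch_absolute_valueD(5)[OF assms(1)] assms(3) in auto)

locale residue_action =
  fixes v :: "'a::alg_closed_field \<Rightarrow> real" and \<iota> :: "'k::finite_field \<Rightarrow> 'a"
  assumes nonarch: "nonarch_absolute_value v"
    and coeff_hom: "ring_hom_on UNIV \<iota>"
    and coeff_integral: "v (\<iota> c) \<le> 1"
begin

abbreviation "ev \<equiv> skew_eval \<iota>"
abbreviation "\<O> \<equiv> val_ring v UNIV"
abbreviation "\<mm> \<equiv> max_ideal v UNIV"

lemmas v = nonarch_absolute_valueD[OF nonarch]
lemmas coeff_eqs = ring_hom_on_eqs[OF is_subring_UNIV coeff_hom, simplified]

lemma coeff_eq_0_iff: "\<iota> c = 0 \<longleftrightarrow> c = 0"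
proof
  assume "\<iota> c = 0"
  then have "\<iota> (c * inverse c) = 0" by (simp only: coeff_eqs mult_zero_left)
  then show "c = 0" using coeff_eqs(2) by (cases "c = 0") auto
qed (simp add: coeff_eqs)

lemma coeff_unit: "c \<noteq> 0 \<Longrightarrow> v (\<iota> c) = 1"
proof -
  assume "c \<noteq> 0"
  then have "v (\<iota> c) * v (\<iota> (inverse c)) = 1"
    by (simp add: v(3)[symmetric] coeff_eqs(4)[symmetric] coeff_eqs(2) v(6))
  moreover have "v (\<iota> c) * v (\<iota> (inverse c)) \<le> v (\<iota> c)"
    using coeff_integral v(1) by (simp add: mult_left_le)
  ultimately show "v (\<iota> c) = 1" using coeff_integral[of c] by simp
qed

lemma CHAR_eq: "CHAR('k) = CHAR('a)"
proof -
  have "of_nat n = (0 :: 'a) \<longleftrightarrow> of_nat n = (0 :: 'k)" for n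
    using coeff_eqs(8)[of "int n"] coeff_eq_0_iff[of "of_nat n"] by simp
  then have "CHAR('a) dvd n \<longleftrightarrow> CHAR('k) dvd n" for n
    by (simp add: of_nat_eq_0_iff_char_dvd)
  then show ?thesis by (metis dvd_antisym dvd_refl)
qed

lemma prime_CHAR: "prime CHAR('k)"
  by (simp add: prime_CHAR_semidom)

lemma frobenius_add: "(x + y :: 'a) ^ (CHAR('k) ^ i) = x ^ (CHAR('k) ^ i) + y ^ (CHAR('k) ^ i)"
  using freshmans_dream'[of "CHAR('k) ^ i" i x y] prime_CHAR by (simp add: CHAR_eq)

lemma frobenius_sum: "(\<Sum>s\<in>S. f s :: 'a) ^ (CHAR('k) ^ i) = (\<Sum>s\<in>S. f s ^ (CHAR('k) ^ i))"
  using freshmans_dream_sum'[of "CHAR('k) ^ i" i f S] prime_CHAR by (simp add: CHAR_eq)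

lemma ev_eq_sum:
  assumes "\<forall>i>n. skew_coeff f i = 0"
  shows "ev f x = (\<Sum>i\<le>n. \<iota> (skew_coeff f i) * x ^ (CHAR('k) ^ i))"
  unfolding skew_eval_def using assms
  by (intro sum.mono_neutral_left) (auto simp: coeff_eqs not_less[symmetric])

lemma ev_eq_sum_degree: "ev f x = (\<Sum>i\<le>skew_degree f. \<iota> (skew_coeff f i) * x ^ (CHAR('k) ^ i))"
  by (rule ev_eq_sum) (simp add: skew_coeff_above_degree)

lemma ev_add: "ev f (x + y) = ev f x + ev f y"
  by (simp add: skew_eval_def frobenius_add distrib_left sum.distrib)

lemma ev_zero: "ev f 0 = 0"
  using ev_add[of f 0 0] by (metis add.right_neutral add_left_cancel)

lemma ev_diff: "ev f (x - y) = ev f x - ev f y"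
  using ev_add[of f "x - y" y] by simp

lemma ev_plus: "ev (f + g) x = ev f x + ev g x"
proof -
  let ?n = "max (skew_degree f) (skew_degree g)"
  have f: "\<forall>i>?n. skew_coeff f i = 0" and g: "\<forall>i>?n. skew_coeff g i = 0"
    by (auto intro: skew_coeff_above_degree)
  then have fg: "\<forall>i>?n. skew_coeff (f + g) i = 0" by (simp add: plus_skew_poly.rep_eq)
  show ?thesis
    unfolding ev_eq_sum[OF f] ev_eq_sum[OF g] ev_eq_sum[OF fg]
    by (simp add: plus_skew_poly.rep_eq coeff_eqs distrib_right sum.distrib)
qed

lemma ev_minus: "ev (f - g) x = ev f x - ev g x"
  using ev_plus[of "f - g" g x] by simp

lemma ev_one: "ev 1 x = x"
  using ev_eq_sum[of 0 1 x] by (simp add: one_skew_poly.rep_eq coeff_eqs)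

lemma ev_mult: "ev (f * g) x = ev f (ev g x)"
proof -
  define m n where "m = skew_degree f" and "n = skew_degree g"
  have f: "skew_coeff f i = 0" if "i > m" for i using that skew_coeff_above_degree m_def by blast
  have g: "skew_coeff g i = 0" if "i > n" for i using that skew_coeff_above_degree n_def by blast
  let ?q = "\<lambda>i. CHAR('k) ^ i"
  define F where "F i l = \<iota> (skew_coeff f i) * \<iota> (skew_coeff g l) ^ ?q i * x ^ ?q (i + l)" for i l
  have p0: "?q i > 0" for i using prime_CHAR by (simp add: prime_gt_0_nat)
  have "ev (f * g) x = (\<Sum>s\<le>m + n. \<iota> (skew_coeff (f * g) s) * x ^ ?q s)"
    by (rule ev_eq_sum) (use skew_coeff_mult_top(2)[OF f g] in blast)
  also have "\<dots> = (\<Sum>s\<le>m + n. \<Sum>i\<le>s. F i (s - i))"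
    by (simp add: F_def times_skew_poly.rep_eq ring_hom_on_sum[OF is_subring_UNIV coeff_hom]
        coeff_eqs sum_distrib_right atMost_atLeast0)
  also have "\<dots> = (\<Sum>(i, l)\<in>{(i, l). i + l \<le> m + n}. F i l)"
    by (rule sum.triangle_reindex_eq[symmetric])
  also have "\<dots> = (\<Sum>(i, l)\<in>{..m} \<times> {..n}. F i l)"
  proof (rule sum.mono_neutral_right)
    have "{(i, l). i + l \<le> m + n} \<subseteq> {..m + n} \<times> {..m + n}" by auto
    then show "finite {(i, l). i + l \<le> m + n}" by (rule finite_subset) simp
    show "\<forall>z\<in>{(i, l). i + l \<le> m + n} - {..m} \<times> {..n}. (case z of (i, l) \<Rightarrow> F i l) = 0"
    proof
      fix z assume z: "z \<in> {(i, l). i + l \<le> m + n} - {..m} \<times> {..n}"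
      obtain i l where il: "z = (i, l)" by fastforce
      then have "skew_coeff f i = 0 \<or> skew_coeff g l = 0" using z f[of i] g[of l] by auto
      then show "(case z of (i, l) \<Rightarrow> F i l) = 0" using p0 il by (auto simp: F_def coeff_eqs)
    qed
  qed auto
  also have "\<dots> = (\<Sum>i\<le>m. \<Sum>l\<le>n. F i l)" by (rule sum.cartesian_product[symmetric])
  also have "\<dots> = (\<Sum>i\<le>m. \<iota> (skew_coeff f i) * (\<Sum>l\<le>n. \<iota> (skew_coeff g l) * x ^ ?q l) ^ ?q i)"
    by (simp add: F_def frobenius_sum sum_distrib_left power_mult_distrib power_mult[symmetric]
        power_add mult_ac)
  also have "\<dots> = ev f (ev g x)" by (simp add: ev_eq_sum_degree m_def n_def)
  finally show ?thesis .
qed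

lemma ev_surj:
  assumes "g \<noteq> 0"
  shows "\<exists>y. ev g y = \<xi>"
proof -
  let ?n = "skew_degree g"
  have p0: "CHAR('k) > 0" using prime_CHAR by (simp add: prime_gt_0_nat)
  define P where "P = (\<Sum>i\<le>?n. monom (\<iota> (skew_coeff g i)) (CHAR('k) ^ i)) - [:\<xi>:]"
  have "coeff P (CHAR('k) ^ ?n) = (\<Sum>i\<le>?n. if i = ?n then \<iota> (skew_coeff g i) else 0)"
    using p0 prime_gt_1_nat[OF prime_CHAR]
    by (auto simp: P_def coeff_sum coeff_pCons split: nat.splits intro!: sum.cong)
  then have "coeff P (CHAR('k) ^ ?n) \<noteq> 0"
    using skew_coeff_degree_nonzero[OF assms] by (simp add: coeff_eq_0_iff)
  then have "degree P \<ge> CHAR('k) ^ ?n" by (rule le_degree)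
  then have "degree P > 0" using p0 by (metis le_zero_eq neq0_conv power_not_zero)
  then obtain y where "poly P y = 0" using alg_closed_imp_poly_has_root by blast
  then have "ev g y = \<xi>"
    using ev_eq_sum_degree[of g y] by (simp add: P_def poly_sum poly_monom)
  then show ?thesis by blast
qed

lemma \<O>_iff: "x \<in> \<O> \<longleftrightarrow> v x \<le> 1" and \<mm>_iff: "x \<in> \<mm> \<longleftrightarrow> v x < 1"
  by (simp_all add: val_ring_def max_ideal_def)

lemma integral_closed:
  "v x \<le> 1 \<Longrightarrow> v y \<le> 1 \<Longrightarrow> v (x + y) \<le> 1" "v x \<le> 1 \<Longrightarrow> v y \<le> 1 \<Longrightarrow> v (x - y) \<le> 1"
  "v x < 1 \<Longrightarrow> v y < 1 \<Longrightarrow> v (x + y) < 1" "v x < 1 \<Longrightarrow> v y < 1 \<Longrightarrow> v (x - y) < 1"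
  using v(4)[of x y] v(8)[of x y] by auto

lemma ev_term_le: "v (\<iota> c * x ^ n) \<le> v x ^ n"
  using coeff_integral[of c] v(1) by (simp add: v mult_left_le_one_le)

lemma ev_integral: "v x \<le> 1 \<Longrightarrow> v (ev f x) \<le> 1"
  unfolding skew_eval_def
  by (rule nonarch_sum_le[OF nonarch], rule order_trans[OF ev_term_le]) (auto simp: power_le_one v)

lemma ev_maximal:
  assumes "v x < 1"
  shows "v (ev f x) < 1"
proof -
  have "v (ev f x) \<le> v x"
    unfolding skew_eval_def
  proof (rule nonarch_sum_le[OF nonarch], rule order_trans[OF ev_term_le])
    fix i show "v x ^ (CHAR('k) ^ i) \<le> v x"
      using power_decreasing[of 1 "CHAR('k) ^ i" "v x"] assms prime_gt_0_nat[OF prime_CHAR]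
      by (simp add: v Suc_le_eq)
  qed (rule v)
  then show ?thesis using assms by simp
qed

text \<open>
  All nonzero coefficients are units, so for \<open>v y > 1\<close> the top term of \<open>g y\<close> dominates the
  others strictly. In particular the kernel of \<open>g\<close> is integral; this is the good reduction of
  the Drinfeld modules.
\<close>

lemma integral_if_ev_integral:
  assumes "g \<noteq> 0" "v (ev g y) \<le> 1"
  shows "v y \<le> 1"
proof (rule ccontr)
  assume "\<not> v y \<le> 1"
  then have y: "v y > 1" by simp
  let ?n = "skew_degree g" and ?q = "\<lambda>i. CHAR('k) ^ i"
  let ?t = "\<lambda>i. \<iota> (skew_coeff g i) * y ^ ?q i"
  have q: "?q i < ?q j" if "i < j" for i j using that prime_gt_1_nat[OF prime_CHAR] by simp
  have top: "v (?t ?n) = v y ^ ?q ?n"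
    using coeff_unit[OF skew_coeff_degree_nonzero[OF assms(1)]] by (simp add: v)
  have "{..?n} = insert ?n {..<?n}" by auto
  then have ev: "ev g y = ?t ?n + (\<Sum>i<?n. ?t i)"
    using ev_eq_sum_degree[of g y] by simp
  have big: "v y ^ ?q ?n > 1" using y prime_gt_0_nat[OF prime_CHAR] by (simp add: one_less_power)
  have "v (\<Sum>i<?n. ?t i) < v y ^ ?q ?n"
  proof -
    let ?B = "v y ^ (?q ?n - 1)"
    have "v (\<Sum>i<?n. ?t i) \<le> ?B"
    proof (rule nonarch_sum_le[OF nonarch], rule order_trans[OF ev_term_le])
      fix i assume "i \<in> {..<?n}"
      then have "?q i \<le> ?q ?n - 1" using q[of i ?n] by simp
      then show "v y ^ ?q i \<le> ?B" using y by (intro power_increasing) auto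
    qed (simp add: v)
    also have "\<dots> < v y ^ ?q ?n"
      using y prime_gt_0_nat[OF prime_CHAR] by (intro power_strict_increasing) auto
    finally show ?thesis .
  qed
  moreover have "v (?t ?n) \<le> max (v (ev g y)) (v (\<Sum>i<?n. ?t i))"
    using v(8)[of "ev g y" "\<Sum>i<?n. ?t i"] ev by simp
  ultimately show False using top big assms(2) by auto
qed

text \<open>
  What the inertia group does to the coefficients and to residues. Speaking of single automorphisms
  keeps the pairing independent of how the group is presented.
\<close>

definition inertial :: "('a \<Rightarrow> 'a) \<Rightarrow> bool" where
  "inertial \<gamma> \<longleftrightarrow>
     ring_hom_on UNIV \<gamma> \<and> (\<forall>c. \<gamma> (\<iota> c) = \<iota> c) \<and> (\<forall>x. v x \<le> 1 \<longrightarrow> v (\<gamma> x - x) < 1)"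

lemma ev_commute:
  assumes "inertial \<gamma>"
  shows "\<gamma> (ev f x) = ev f (\<gamma> x)"
proof -
  have \<gamma>: "ring_hom_on UNIV \<gamma>" "\<And>c. \<gamma> (\<iota> c) = \<iota> c" using assms by (auto simp: inertial_def)
  show ?thesis
    unfolding skew_eval_def
    by (simp add: ring_hom_on_sum[OF is_subring_UNIV \<gamma>(1)] ring_hom_on_eqs[OF is_subring_UNIV \<gamma>(1)] \<gamma>(2))
qed

lemma inertial_diff:
  "inertial \<gamma> \<Longrightarrow> \<gamma> (x - y) - (x - y) = (\<gamma> x - x) - (\<gamma> y - y)"
  using ring_hom_on_eqs(6)[OF is_subring_UNIV, of \<gamma> x y] by (simp add: inertial_def)

lemma ev_defect: "inertial \<gamma> \<Longrightarrow> ev f (\<gamma> y - y) = \<gamma> (ev f y) - ev f y"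
  by (simp add: ev_diff ev_commute)

text \<open>
  The defect \<open>\<gamma> y - y\<close> of a division point of a fixed element is killed by \<open>g\<close>.
\<close>

lemma defect_integral:
  assumes "inertial \<gamma>" "g \<noteq> 0" "\<gamma> (ev g y) = ev g y"
  shows "v (\<gamma> y - y) \<le> 1"
  by (rule integral_if_ev_integral[OF assms(2)]) (simp add: ev_defect assms v)

text \<open>
  Modulo the maximal ideal the defect of \<open>x\<close> depends only on the class of \<open>g x\<close> modulo integral
  elements: inertia acts trivially on residues.
\<close>

lemma defect_small:
  assumes "inertial \<gamma>" "g \<noteq> 0" "v (ev g x - ev g y) \<le> 1"
  shows "v ((\<gamma> x - x) - (\<gamma> y - y)) < 1"
proof -
  have "v (x - y) \<le> 1" using integral_if_ev_integral[OF assms(2), of "x - y"] assms(3) by (simp add: ev_diff)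
  then have "v (\<gamma> (x - y) - (x - y)) < 1" using assms(1) by (simp add: inertial_def)
  then show ?thesis by (simp add: inertial_diff[OF assms(1)])
qed

end


section \<open>Classes in the maximal abelian quotient of exponent p of inertia\<close>

context residue_action
begin

lemma inertial_integral:
  assumes "inertial \<gamma>" "v x \<le> 1"
  shows "v (\<gamma> x) \<le> 1"
proof -
  have "v (\<gamma> x - x) \<le> 1" using assms by (auto simp: inertial_def intro: less_imp_le)
  then show ?thesis using integral_closed(1)[of "\<gamma> x - x" x] assms(2) by simp
qed

text \<open>
  If \<open>x\<close> is not integral, then \<open>1/x\<close> lies in the maximal ideal, which \<open>\<gamma>\<close> preserves, so
  \<open>\<gamma> x\<close> is not integral either. This is what makes the inverse of \<open>\<gamma>\<close> act trivially on residues.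
\<close>

lemma integral_if_inertial_image_integral:
  assumes "inertial \<gamma>" "v (\<gamma> x) \<le> 1"
  shows "v x \<le> 1"
proof (rule ccontr)
  assume "\<not> v x \<le> 1"
  then have x: "v x > 1" by simp
  note hom = ring_hom_on_eqs[OF is_subring_UNIV, of \<gamma>, simplified]
  have \<gamma>: "ring_hom_on UNIV \<gamma>" using assms(1) by (simp add: inertial_def)
  have inv: "v (inverse x) < 1" using x by (simp add: v inverse_less_1_iff)
  then have "v (\<gamma> (inverse x) - inverse x) < 1" using assms(1) by (simp add: inertial_def)
  then have small: "v (\<gamma> (inverse x)) < 1"
    using integral_closed(3)[of "\<gamma> (inverse x) - inverse x" "inverse x"] inv by simp
  have "\<gamma> x * \<gamma> (inverse x) = 1"
    using hom(4)[OF \<gamma>, of x "inverse x"] hom(2)[OF \<gamma>] x v(5) by (cases "x = 0") auto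
  then have "v (\<gamma> x) * v (\<gamma> (inverse x)) = 1" using v(3) v(6) by metis
  moreover have "v (\<gamma> x) * v (\<gamma> (inverse x)) \<le> v (\<gamma> (inverse x))"
    using assms(2) by (simp add: mult_left_le_one_le v)
  ultimately show False using small by simp
qed

context
  fixes K :: "'a set"
  assumes coeff_in_K: "range \<iota> \<subseteq> K"
begin

abbreviation "G \<equiv> inertia_group v K"

lemma coeff_in_perfection: "\<iota> c \<in> perfection K"
  unfolding perfection_def using coeff_in_K by (auto intro!: exI[of _ 0])

lemma inertia_groupD:
  assumes "\<gamma> \<in> carrier G"
  shows "bij \<gamma>" "ring_hom_on UNIV \<gamma>" "x \<in> perfection K \<Longrightarrow> \<gamma> x = x" "inertial \<gamma>"
  using assms coeff_in_perfection
  by (auto simp: inertia_group_def galois_group_def inertial_def \<O>_iff \<mm>_iff)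

lemma inertia_groupI:
  assumes "bij \<gamma>" "ring_hom_on UNIV \<gamma>" "\<And>x. x \<in> perfection K \<Longrightarrow> \<gamma> x = x"
    "\<And>x. v x \<le> 1 \<Longrightarrow> v (\<gamma> x - x) < 1"
  shows "\<gamma> \<in> carrier G"
  using assms by (auto simp: inertia_group_def galois_group_def \<O>_iff \<mm>_iff)

lemma inertia_group_ops: "x \<otimes>\<^bsub>G\<^esub> y = x \<circ> y" "\<one>\<^bsub>G\<^esub> = id"
  by (simp_all add: inertia_group_def galois_group_def)

lemma inertia_group_comp:
  assumes "\<gamma> \<in> carrier G" "\<delta> \<in> carrier G"
  shows "\<gamma> \<circ> \<delta> \<in> carrier G"
proof (rule inertia_groupI)
  note \<gamma> = inertia_groupD[OF assms(1)] and \<delta> = inertia_groupD[OF assms(2)]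
  show "bij (\<gamma> \<circ> \<delta>)" using \<gamma>(1) \<delta>(1) by (rule bij_comp[rotated])
  show "ring_hom_on UNIV (\<gamma> \<circ> \<delta>)" using \<gamma>(2) \<delta>(2) by (auto simp: ring_hom_on_def)
  show "(\<gamma> \<circ> \<delta>) x = x" if "x \<in> perfection K" for x using \<gamma>(3) \<delta>(3) that by simp
  show "v ((\<gamma> \<circ> \<delta>) x - x) < 1" if "v x \<le> 1" for x
  proof -
    have "v (\<delta> x - x) < 1" "v (\<gamma> (\<delta> x) - \<delta> x) < 1"
      using \<gamma>(4) \<delta>(4) inertial_integral[OF \<delta>(4) that] that by (auto simp: inertial_def)
    then show ?thesis using integral_closed(3)[of "\<gamma> (\<delta> x) - \<delta> x" "\<delta> x - x"] by simp
  qed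
qed

lemma inertia_group_inv:
  assumes "\<gamma> \<in> carrier G"
  shows "inv_into UNIV \<gamma> \<in> carrier G"
proof (rule inertia_groupI)
  note \<gamma> = inertia_groupD[OF assms]
  have l: "inv_into UNIV \<gamma> (\<gamma> x) = x" for x using \<gamma>(1) by (simp add: bij_is_inj)
  have r: "\<gamma> (inv_into UNIV \<gamma> x) = x" for x using \<gamma>(1) by (simp add: bij_is_surj surj_f_inv_f)
  have \<gamma>_eqs: "\<gamma> (x + y) = \<gamma> x + \<gamma> y" "\<gamma> (x * y) = \<gamma> x * \<gamma> y" "\<gamma> 1 = 1" for x y
    using \<gamma>(2) by (auto simp: ring_hom_on_def)
  show "bij (inv_into UNIV \<gamma>)" using \<gamma>(1) by (rule bij_imp_bij_inv)
  show "ring_hom_on UNIV (inv_into UNIV \<gamma>)"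
    unfolding ring_hom_on_def
  proof (intro conjI ballI)
    show "inv_into UNIV \<gamma> 1 = 1" using l[of 1] by (simp add: \<gamma>_eqs)
    fix x y
    show "inv_into UNIV \<gamma> (x + y) = inv_into UNIV \<gamma> x + inv_into UNIV \<gamma> y"
      using l[of "inv_into UNIV \<gamma> x + inv_into UNIV \<gamma> y"] by (simp add: \<gamma>_eqs r)
    show "inv_into UNIV \<gamma> (x * y) = inv_into UNIV \<gamma> x * inv_into UNIV \<gamma> y"
      using l[of "inv_into UNIV \<gamma> x * inv_into UNIV \<gamma> y"] by (simp add: \<gamma>_eqs r)
  qed
  show "inv_into UNIV \<gamma> x = x" if "x \<in> perfection K" for x
    using l[of x] \<gamma>(3)[OF that] by simp
  show "v (inv_into UNIV \<gamma> x - x) < 1" if "v x \<le> 1" for x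
  proof -
    let ?z = "inv_into UNIV \<gamma> x"
    have "v ?z \<le> 1" using integral_if_inertial_image_integral[OF \<gamma>(4), of ?z] that by (simp add: r)
    then have "v (\<gamma> ?z - ?z) < 1" using \<gamma>(4) by (simp add: inertial_def)
    then show ?thesis using v(7)[of "\<gamma> ?z - ?z"] by (simp add: r)
  qed
qed

lemma group_inertia_group: "group G"
proof (rule groupI)
  show "\<one>\<^bsub>G\<^esub> \<in> carrier G"
    unfolding inertia_group_ops by (rule inertia_groupI) (auto simp: ring_hom_on_def v)
  fix x assume x: "x \<in> carrier G"
  then show "\<exists>y\<in>carrier G. y \<otimes>\<^bsub>G\<^esub> x = \<one>\<^bsub>G\<^esub>"
    using inertia_group_inv[OF x] inertia_groupD(1)[OF x]
    by (intro bexI[of _ "inv_into UNIV x"]) (auto simp: inertia_group_ops bij_is_inj)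
qed (auto simp: inertia_group_ops inertia_group_comp o_assoc)

context
  fixes y :: 'a
  assumes defect: "\<And>\<gamma>. \<gamma> \<in> carrier G \<Longrightarrow> v (\<gamma> y - y) \<le> 1"
begin

text \<open>
  For fixed \<open>y\<close> the map \<open>\<gamma> \<mapsto> \<gamma> y - y\<close> is a homomorphism to the residue field of \<open>K\<^sup>a\<^sup>l\<^sup>g\<close>,
  since \<open>\<gamma>\<close> moves the integral element \<open>\<delta> y - y\<close> only within its residue class. Its target is
  abelian of exponent \<open>p\<close> and it is continuous, so it factors over \<open>J\<^sub>K\<close>; the lemmas up to
  \<open>J_group_class_defect\<close> carry this out on representatives.
\<close>

lemma defect_comp:
  assumes "\<gamma> \<in> carrier G" "\<delta> \<in> carrier G"
  shows "v (((\<gamma> \<circ> \<delta>) y - y) - ((\<gamma> y - y) + (\<delta> y - y))) < 1"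
proof -
  note \<gamma> = inertia_groupD[OF assms(1)]
  have "v (\<gamma> (\<delta> y - y) - (\<delta> y - y)) < 1"
    using \<gamma>(4) defect[OF assms(2)] by (simp add: inertial_def)
  then show ?thesis
    using ring_hom_on_eqs(6)[OF is_subring_UNIV \<gamma>(2), of "\<delta> y" y] by (simp add: algebra_simps)
qed

lemma subgroup_defect_small: "subgroup {\<gamma> \<in> carrier G. v (\<gamma> y - y) < 1} G"
proof -
  interpret group G by (rule group_inertia_group)
  have inv_eq: "(inv\<^bsub>G\<^esub> \<gamma>) (\<gamma> y) = y" if "\<gamma> \<in> carrier G" for \<gamma>
    using fun_cong[OF l_inv[OF that], of y] by (simp add: inertia_group_ops)
  show ?thesis
  proof (rule subgroupI)
    have "id \<in> carrier G" using one_closed by (simp add: inertia_group_ops)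
    then show "{\<gamma> \<in> carrier G. v (\<gamma> y - y) < 1} \<noteq> {}" using v(5) by (auto intro!: exI[of _ id])
    fix a assume a: "a \<in> {\<gamma> \<in> carrier G. v (\<gamma> y - y) < 1}"
    have "v (((inv\<^bsub>G\<^esub> a \<circ> a) y - y) - (((inv\<^bsub>G\<^esub> a) y - y) + (a y - y))) < 1"
      using a by (intro defect_comp) auto
    moreover have "(inv\<^bsub>G\<^esub> a \<circ> a) y - y = 0" using a inv_eq by simp
    ultimately have "v (((inv\<^bsub>G\<^esub> a) y - y) + (a y - y)) < 1"
      using v(7)[of "((inv\<^bsub>G\<^esub> a) y - y) + (a y - y)"] by (simp only: diff_0)
    then have "v ((inv\<^bsub>G\<^esub> a) y - y) < 1"
      using a integral_closed(4)[of "((inv\<^bsub>G\<^esub> a) y - y) + (a y - y)" "a y - y"] by simp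
    then show "inv\<^bsub>G\<^esub> a \<in> {\<gamma> \<in> carrier G. v (\<gamma> y - y) < 1}" using a by auto
    fix b assume b: "b \<in> {\<gamma> \<in> carrier G. v (\<gamma> y - y) < 1}"
    have "v (((a \<circ> b) y - y) - ((a y - y) + (b y - y))) < 1" using a b by (intro defect_comp) auto
    moreover have "v ((a y - y) + (b y - y)) < 1" using a b integral_closed(3) by blast
    ultimately have "v ((a \<circ> b) y - y) < 1"
      using integral_closed(3)[of "((a \<circ> b) y - y) - ((a y - y) + (b y - y))" "(a y - y) + (b y - y)"]
      by simp
    then show "a \<otimes>\<^bsub>G\<^esub> b \<in> {\<gamma> \<in> carrier G. v (\<gamma> y - y) < 1}"
      using a b by (auto simp: inertia_group_ops inertia_group_comp)
  qed auto
qed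

lemma derived_defect_small: "\<gamma> \<in> derived G (carrier G) \<Longrightarrow> v (\<gamma> y - y) < 1"
proof -
  interpret group G by (rule group_inertia_group)
  let ?H = "{\<gamma> \<in> carrier G. v (\<gamma> y - y) < 1}"
  have "h1 \<otimes>\<^bsub>G\<^esub> h2 \<otimes>\<^bsub>G\<^esub> inv\<^bsub>G\<^esub> h1 \<otimes>\<^bsub>G\<^esub> inv\<^bsub>G\<^esub> h2 \<in> ?H"
    if h: "h1 \<in> carrier G" "h2 \<in> carrier G" for h1 h2
  proof -
    let ?c = "\<lambda>\<gamma>. \<gamma> y - y"
    \<comment> \<open>a commutator is the quotient of \<open>h1 \<circ> h2\<close> by \<open>h2 \<circ> h1\<close>, which have the same defect modulo \<open>\<mm>\<close>\<close>
    have eq: "h1 \<otimes>\<^bsub>G\<^esub> h2 \<otimes>\<^bsub>G\<^esub> inv\<^bsub>G\<^esub> h1 \<otimes>\<^bsub>G\<^esub> inv\<^bsub>G\<^esub> h2 = (h1 \<circ> h2) \<circ> inv\<^bsub>G\<^esub> (h2 \<circ> h1)"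
      using h by (simp add: inertia_group_ops[symmetric] inv_mult_group m_assoc)
    have c12: "h1 \<circ> h2 \<in> carrier G" and c21: "h2 \<circ> h1 \<in> carrier G"
      using h inertia_group_comp by auto
    then have ci: "inv\<^bsub>G\<^esub> (h2 \<circ> h1) \<in> carrier G" by simp
    have one: "(h2 \<circ> h1) \<circ> inv\<^bsub>G\<^esub> (h2 \<circ> h1) = id" using r_inv[OF c21] by (simp add: inertia_group_ops)
    have a1: "v (?c ((h1 \<circ> h2) \<circ> inv\<^bsub>G\<^esub> (h2 \<circ> h1)) - (?c (h1 \<circ> h2) + ?c (inv\<^bsub>G\<^esub> (h2 \<circ> h1)))) < 1"
      by (rule defect_comp[OF c12 ci])
    have "v (?c ((h2 \<circ> h1) \<circ> inv\<^bsub>G\<^esub> (h2 \<circ> h1)) - (?c (h2 \<circ> h1) + ?c (inv\<^bsub>G\<^esub> (h2 \<circ> h1)))) < 1"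
      by (rule defect_comp[OF c21 ci])
    then have a2: "v (0 - (?c (h2 \<circ> h1) + ?c (inv\<^bsub>G\<^esub> (h2 \<circ> h1)))) < 1" unfolding one by simp
    note b1 = defect_comp[OF h] and b2 = defect_comp[OF h(2,1)]
    have "v ((?c ((h1 \<circ> h2) \<circ> inv\<^bsub>G\<^esub> (h2 \<circ> h1)) - (?c (h1 \<circ> h2) + ?c (inv\<^bsub>G\<^esub> (h2 \<circ> h1))))
        - (0 - (?c (h2 \<circ> h1) + ?c (inv\<^bsub>G\<^esub> (h2 \<circ> h1))))
        + ((?c (h1 \<circ> h2) - (?c h1 + ?c h2)) - (?c (h2 \<circ> h1) - (?c h2 + ?c h1)))) < 1"
      by (rule integral_closed(3)[OF integral_closed(4)[OF a1 a2] integral_closed(4)[OF b1 b2]])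
    then have "v (?c ((h1 \<circ> h2) \<circ> inv\<^bsub>G\<^esub> (h2 \<circ> h1))) < 1"
      by (simp add: algebra_simps)
    then show ?thesis using eq inertia_group_comp[OF c12 ci] by simp
  qed
  then have "derived_set G (carrier G) \<subseteq> ?H" by blast
  then have "derived G (carrier G) \<subseteq> ?H"
    unfolding derived_def by (rule generate_subgroup_incl[OF _ subgroup_defect_small])
  then show "\<gamma> \<in> derived G (carrier G) \<Longrightarrow> v (\<gamma> y - y) < 1" by blast
qed

text \<open>
  The defect of \<open>y\<close> depends only on the value at \<open>y\<close>, so it is constant on a neighbourhood of
  \<open>\<gamma>\<close> in the Krull topology.
\<close>

lemma derived_closure_defect_small:
  assumes "\<gamma> \<in> krull_topology (carrier G) closure_of derived G (carrier G)"
  shows "\<gamma> \<in> carrier G" "v (\<gamma> y - y) < 1"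
proof -
  let ?T = "product_topology (\<lambda>_ :: 'a. discrete_topology (UNIV :: 'a set)) UNIV"
  have "openin ?T {\<delta> \<in> topspace ?T. \<delta> y \<in> {\<gamma> y}}"
    by (rule openin_continuous_map_preimage[OF continuous_map_product_projection]) auto
  then have op: "openin (krull_topology (carrier G)) ({\<delta>. \<delta> y = \<gamma> y} \<inter> carrier G)"
    unfolding krull_topology_def openin_subtopology by (auto simp: PiE_UNIV_domain)
  show G: "\<gamma> \<in> carrier G"
    using assms unfolding in_closure_of krull_topology_def by auto
  have "\<exists>\<delta>. \<delta> \<in> derived G (carrier G) \<and> \<delta> \<in> {\<delta>. \<delta> y = \<gamma> y} \<inter> carrier G"
    by (rule conjunct2[OF assms[unfolded in_closure_of], rule_format]) (use op G in simp)
  then obtain \<delta> where "\<delta> \<in> derived G (carrier G)" "\<delta> y = \<gamma> y" by blast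
  then show "v (\<gamma> y - y) < 1" using derived_defect_small[of \<delta>] by simp
qed

lemma profinite_ab_coset_defect:
  assumes "Y \<in> carrier (profinite_ab G)"
  obtains h where "h \<in> carrier G"
    "\<And>\<gamma>. \<gamma> \<in> Y \<Longrightarrow> \<gamma> \<in> carrier G \<and> v ((\<gamma> y - y) - (h y - y)) < 1"
proof -
  let ?N = "krull_topology (carrier G) closure_of derived G (carrier G)"
  obtain h where h: "h \<in> carrier G" "Y = ?N #>\<^bsub>G\<^esub> h"
    using assms by (auto simp: profinite_ab_def FactGroup_def RCOSETS_def)
  have "\<gamma> \<in> carrier G \<and> v ((\<gamma> y - y) - (h y - y)) < 1" if "\<gamma> \<in> Y" for \<gamma>
  proof -
    obtain n where n: "n \<in> ?N" "\<gamma> = n \<circ> h"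
      using \<open>\<gamma> \<in> Y\<close> unfolding h(2) r_coset_def inertia_group_ops by blast
    note n' = derived_closure_defect_small[OF n(1)]
    have "v (((n \<circ> h) y - y) - ((n y - y) + (h y - y))) < 1" by (rule defect_comp[OF n'(1) h(1)])
    from integral_closed(3)[OF this n'(2)]
    show ?thesis using n(2) inertia_group_comp[OF n'(1) h(1)] by (simp add: algebra_simps)
  qed
  then show thesis using h(1) that by blast
qed

lemma profinite_ab_power_defect:
  assumes "Y \<in> carrier (profinite_ab G)" "h \<in> carrier G"
    "\<And>\<gamma>. \<gamma> \<in> Y \<Longrightarrow> \<gamma> \<in> carrier G \<and> v ((\<gamma> y - y) - (h y - y)) < 1"
    and "\<gamma> \<in> Y [^]\<^bsub>profinite_ab G\<^esub> (n :: nat)"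
  shows "\<gamma> \<in> carrier G \<and> v ((\<gamma> y - y) - of_nat n * (h y - y)) < 1"
  using assms(4)
proof (induction n arbitrary: \<gamma>)
  case 0
  then have "\<gamma> \<in> krull_topology (carrier G) closure_of derived G (carrier G)"
    by (simp add: profinite_ab_def FactGroup_def)
  then show ?case using derived_closure_defect_small by auto
next
  case (Suc n)
  then have "\<gamma> \<in> (Y [^]\<^bsub>profinite_ab G\<^esub> n) <#>\<^bsub>G\<^esub> Y"
    by (simp add: profinite_ab_def FactGroup_def)
  then obtain a b where ab: "a \<in> Y [^]\<^bsub>profinite_ab G\<^esub> n" "b \<in> Y" "\<gamma> = a \<circ> b"
    by (auto simp: set_mult_def inertia_group_ops)
  note a = Suc.IH[OF ab(1)] and b = assms(3)[OF ab(2)]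
  have "v (((a \<circ> b) y - y) - ((a y - y) + (b y - y))) < 1"
    using a b by (intro defect_comp) auto
  from integral_closed(3)[OF integral_closed(3)[OF this conjunct2[OF a]] conjunct2[OF b]]
  have "v ((\<gamma> y - y) - of_nat (Suc n) * (h y - y)) < 1" using ab(3) by (simp add: algebra_simps)
  then show ?case using a b ab(3) inertia_group_comp by blast
qed

lemma J_group_class_defect:
  assumes "C \<in> carrier (J_group v K)" "\<gamma> \<in> \<Union>C" "\<delta> \<in> \<Union>C"
  shows "\<gamma> \<in> carrier G" "v (\<gamma> y - \<delta> y) < 1"
proof -
  let ?P = "profinite_ab G"
  obtain Y where Y: "Y \<in> carrier ?P" "C = ((\<lambda>g. g [^]\<^bsub>?P\<^esub> CHAR('a)) ` carrier ?P) #>\<^bsub>?P\<^esub> Y"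
    using assms(1) by (auto simp: J_group_def mod_powers_def FactGroup_def RCOSETS_def)
  obtain h where h: "h \<in> carrier G"
    "\<And>\<gamma>. \<gamma> \<in> Y \<Longrightarrow> \<gamma> \<in> carrier G \<and> v ((\<gamma> y - y) - (h y - y)) < 1"
    using profinite_ab_coset_defect[OF Y(1)] by blast
  have near: "\<gamma> \<in> carrier G \<and> v ((\<gamma> y - y) - (h y - y)) < 1" if "\<gamma> \<in> \<Union>C" for \<gamma>
  proof -
    obtain Z where Z: "Z \<in> carrier ?P" "\<gamma> \<in> (Z [^]\<^bsub>?P\<^esub> CHAR('a)) \<otimes>\<^bsub>?P\<^esub> Y"
      using \<open>\<gamma> \<in> \<Union>C\<close> Y(2) by (auto simp: r_coset_def)
    then have "\<gamma> \<in> (Z [^]\<^bsub>?P\<^esub> CHAR('a)) <#>\<^bsub>G\<^esub> Y"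
      by (simp add: profinite_ab_def FactGroup_def)
    then obtain a b where ab: "a \<in> Z [^]\<^bsub>?P\<^esub> CHAR('a)" "b \<in> Y" "\<gamma> = a \<circ> b"
      by (auto simp: set_mult_def inertia_group_ops)
    obtain g where g: "g \<in> carrier G"
      "\<And>\<gamma>. \<gamma> \<in> Z \<Longrightarrow> \<gamma> \<in> carrier G \<and> v ((\<gamma> y - y) - (g y - y)) < 1"
      using profinite_ab_coset_defect[OF Z(1)] by blast
    have a: "a \<in> carrier G \<and> v (a y - y) < 1"
      using profinite_ab_power_defect[OF Z(1) g ab(1)] by simp
    note b = h(2)[OF ab(2)]
    have "v (((a \<circ> b) y - y) - ((a y - y) + (b y - y))) < 1"
      using a b by (intro defect_comp) auto
    from integral_closed(3)[OF integral_closed(3)[OF this conjunct2[OF a]] conjunct2[OF b]]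
    show ?thesis using ab(3) a b inertia_group_comp by (simp add: algebra_simps)
  qed
  show "\<gamma> \<in> carrier G" using near[OF assms(2)] by blast
  show "v (\<gamma> y - \<delta> y) < 1"
    using integral_closed(4)[OF conjunct2[OF near[OF assms(2)]] conjunct2[OF near[OF assms(3)]]]
    by (simp add: algebra_simps)
qed

end

lemma J_group_class_nonempty:
  assumes "C \<in> carrier (J_group v K)"
  shows "\<Union>C \<noteq> {}"
proof -
  interpret group G by (rule group_inertia_group)
  let ?P = "profinite_ab G"
  let ?N = "krull_topology (carrier G) closure_of derived G (carrier G)"
  have "\<one>\<^bsub>G\<^esub> \<in> derived G (carrier G)" unfolding derived_def by (rule generate.one)
  moreover have "derived G (carrier G) \<subseteq> topspace (krull_topology (carrier G))"
    unfolding krull_topology_def using derived_in_carrier[of "carrier G"]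
    by (auto simp: PiE_UNIV_domain)
  ultimately have N: "\<one>\<^bsub>G\<^esub> \<in> ?N" using closure_of_subset by blast
  have ne: "Y \<noteq> {}" if "Y \<in> carrier ?P" for Y
    using that N by (auto simp: profinite_ab_def FactGroup_def RCOSETS_def r_coset_def)
  have pow: "Y [^]\<^bsub>?P\<^esub> n \<noteq> {}" if "Y \<noteq> {}" for Y and n :: nat
  proof (induction n)
    case 0
    then show ?case using N by (auto simp: profinite_ab_def FactGroup_def)
  next
    case (Suc n)
    then show ?case using that by (auto simp: profinite_ab_def FactGroup_def set_mult_def)
  qed
  obtain Y where Y: "Y \<in> carrier ?P" "C = ((\<lambda>g. g [^]\<^bsub>?P\<^esub> CHAR('a)) ` carrier ?P) #>\<^bsub>?P\<^esub> Y"
    using assms by (auto simp: J_group_def mod_powers_def FactGroup_def RCOSETS_def)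
  have "(Y [^]\<^bsub>?P\<^esub> CHAR('a)) \<otimes>\<^bsub>?P\<^esub> Y \<in> C"
    using Y by (auto simp: r_coset_def)
  moreover have "(Y [^]\<^bsub>?P\<^esub> CHAR('a)) \<otimes>\<^bsub>?P\<^esub> Y = (Y [^]\<^bsub>?P\<^esub> CHAR('a)) <#>\<^bsub>G\<^esub> Y"
    by (simp add: profinite_ab_def FactGroup_def)
  moreover have "(Y [^]\<^bsub>?P\<^esub> CHAR('a)) <#>\<^bsub>G\<^esub> Y \<noteq> {}"
    using ne[OF Y(1)] pow by (auto simp: set_mult_def)
  ultimately show ?thesis by auto
qed

end

end


section \<open>Cosets and induced maps\<close>

definition add_subgroup :: "'a::ab_group_add set \<Rightarrow> bool" where
  "add_subgroup N \<longleftrightarrow> 0 \<in> N \<and> (\<forall>x\<in>N. \<forall>y\<in>N. x - y \<in> N)"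

lemma add_subgroupD:
  assumes "add_subgroup N"
  shows "0 \<in> N" "x \<in> N \<Longrightarrow> y \<in> N \<Longrightarrow> x - y \<in> N" "x \<in> N \<Longrightarrow> - x \<in> N"
    "x \<in> N \<Longrightarrow> y \<in> N \<Longrightarrow> x + y \<in> N"
proof -
  have N: "0 \<in> N" "\<And>x y. x \<in> N \<Longrightarrow> y \<in> N \<Longrightarrow> x - y \<in> N"
    using assms by (auto simp: add_subgroup_def)
  have minus: "- x \<in> N" if "x \<in> N" for x using N(2)[OF N(1) that] by simp
  show "0 \<in> N" "x \<in> N \<Longrightarrow> y \<in> N \<Longrightarrow> x - y \<in> N" "x \<in> N \<Longrightarrow> - x \<in> N"
    using N minus by auto
  show "x + y \<in> N" if "x \<in> N" "y \<in> N" using N(2)[OF that(1) minus[OF that(2)]] by simp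
qed

lemma is_subring_add_subgroup: "is_subring S \<Longrightarrow> add_subgroup S"
  by (simp add: is_subring_def add_subgroup_def)

lemma coset_eq_iff:
  assumes "add_subgroup N"
  shows "x +o N = y +o N \<longleftrightarrow> x - y \<in> N"
proof
  assume "x +o N = y +o N"
  then have "x + 0 \<in> y +o N" using add_subgroupD(1)[OF assms] by (metis set_plus_intro2)
  then show "x - y \<in> N" by (auto simp: elt_set_plus_def)
next
  have sub: "x +o N \<subseteq> y +o N" if "x - y \<in> N" for x y
  proof
    fix z assume "z \<in> x +o N"
    then obtain n where n: "n \<in> N" "z = x + n" by (auto simp: elt_set_plus_def)
    then have "z = y + ((x - y) + n)" by simp
    then show "z \<in> y +o N" using add_subgroupD(4)[OF assms that n(1)] by (metis set_plus_intro2)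
  qed
  assume "x - y \<in> N"
  moreover from this have "y - x \<in> N" using add_subgroupD(3)[OF assms, of "x - y"] by simp
  ultimately show "x +o N = y +o N" using sub by blast
qed

lemma coset_plus:
  assumes "add_subgroup N"
  shows "(x +o N) + (y +o N) = (x + y) +o N"
proof -
  have "N + N = N"
  proof
    show "N + N \<subseteq> N" using add_subgroupD(4)[OF assms] by (auto simp: set_plus_def)
    show "N \<subseteq> N + N" using add_subgroupD(1)[OF assms] by (metis set_zero_plus2)
  qed
  then show ?thesis by (simp add: set_plus_rearrange)
qed

lemma induced_coset:
  assumes N: "add_subgroup N" "add_subgroup N'"
    and g: "\<And>n. n \<in> N \<Longrightarrow> g (x + n) - g x \<in> N'"
  shows "induced g N' (x +o N) = g x +o N'"
proof -
  have "g (x + n) +o N' = g x +o N'" if "n \<in> N" for n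
    using g[OF that] by (simp add: coset_eq_iff[OF N(2)])
  then have "induced g N' (x +o N) = (\<Union>n\<in>N. g x +o N')"
    unfolding induced_def elt_set_plus_def[of x] by auto
  then show ?thesis using add_subgroupD(1)[OF N(1)] by auto
qed


section \<open>The pairing over the skew polynomial ring\<close>

text \<open>
  A class of elements \<open>\<xi>\<close> modulo integral elements and a class of automorphisms \<open>\<gamma>\<close> that have the
  same defects on all division points of these \<open>\<xi>\<close>.
\<close>

locale kummer_class = residue_action v \<iota>
  for v :: "'a::alg_closed_field \<Rightarrow> real" and \<iota> :: "'k::finite_field \<Rightarrow> 'a" +
  fixes j :: "'k skew_poly \<Rightarrow> 'd::division_ring" and X :: "'a set" and \<Gamma> :: "('a \<Rightarrow> 'a) set"
  assumes j: "total_quotient_ring j"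
    and X_nonempty: "X \<noteq> {}" and \<Gamma>_nonempty: "\<Gamma> \<noteq> {}"
    and X_diff: "\<xi> \<in> X \<Longrightarrow> \<xi>' \<in> X \<Longrightarrow> v (\<xi> - \<xi>') \<le> 1"
    and \<Gamma>_inertial: "\<gamma> \<in> \<Gamma> \<Longrightarrow> inertial \<gamma>"
    and \<Gamma>_fixes: "\<gamma> \<in> \<Gamma> \<Longrightarrow> \<xi> \<in> X \<Longrightarrow> \<gamma> \<xi> = \<xi>"
    and \<Gamma>_diff: "\<gamma> \<in> \<Gamma> \<Longrightarrow> \<gamma>' \<in> \<Gamma> \<Longrightarrow> g \<noteq> 0 \<Longrightarrow> ev g y \<in> X \<Longrightarrow> v (\<gamma> y - \<gamma>' y) < 1"
begin

lemma j_hom: "ring_hom_on UNIV j" and j_inj: "inj j"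
  and j_frac: "\<exists>f g. g \<noteq> 0 \<and> x = j f / j g"
  using j by (auto simp: total_quotient_ring_def)

lemmas j_eqs = ring_hom_on_eqs[OF is_subring_UNIV j_hom, simplified]

lemma j_eq_0_iff: "j f = 0 \<longleftrightarrow> f = 0"
  using j_inj j_eqs(1) by (metis injD)

lemma j_expand: "h \<noteq> 0 \<Longrightarrow> g \<noteq> 0 \<Longrightarrow> j (f * h) / j (g * h) = j f / j g"
  by (simp add: divide_inverse j_eqs nonzero_inverse_mult_distrib j_eq_0_iff mult.assoc[symmetric])
    (simp add: mult.assoc j_eq_0_iff)

lemma add_subgroups: "add_subgroup (range j)" "add_subgroup \<mm>"
  by (auto simp: add_subgroup_def \<mm>_iff v intro: integral_closed)
    (metis j_eqs(1) rangeI, metis j_eqs(6) rangeI)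

text \<open>
  The heart of the proof. The value \<open>f (\<gamma> y - y)\<close> with \<open>g y = \<xi>\<close> depends modulo the maximal ideal
  only on the class of \<open>f g\<^sup>-\<^sup>1\<close> in \<open>D/R\<close>. With a common denominator \<open>g h = g' h'\<close> and a root \<open>z\<close>
  of \<open>g h z = \<xi>\<close>, the points \<open>y\<close> and \<open>y'\<close> may be replaced by \<open>h z\<close> and \<open>h' z\<close>. The two values
  then differ by \<open>(f h - f' h') (\<gamma> z - z) = r g h (\<gamma> z - z) = r (\<gamma> \<xi> - \<xi>) = 0\<close>.
\<close>

lemma kummer_value_well_defined:
  assumes g: "g \<noteq> 0" "g' \<noteq> 0" and r: "j f / j g - j f' / j g' \<in> range j"
    and y: "ev g y \<in> X" "ev g' y' \<in> X" and \<gamma>: "\<gamma> \<in> \<Gamma>" "\<gamma>' \<in> \<Gamma>"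
  shows "v (ev f (\<gamma> y - y) - ev f' (\<gamma>' y' - y')) < 1"
proof -
  obtain r where r: "j f / j g - j f' / j g' = j r" using r by auto
  obtain h h' where h: "g * h = g' * h'" "g * h \<noteq> 0"
    using skew_common_right_multiple[OF g] by blast
  then have h0: "h \<noteq> 0" "h' \<noteq> 0" by auto
  have eq: "j (f * h - f' * h') / j (g * h) = j r"
    using r j_expand[OF h0(1) g(1), of f] j_expand[OF h0(2) g(2), of f'] h(1)
    by (simp add: j_eqs diff_divide_distrib)
  have nz: "j (g * h) \<noteq> 0" using h(2) j_eq_0_iff by blast
  have "j (f * h - f' * h') = j r * j (g * h)"
    using iffD1[OF nonzero_divide_eq_eq[OF nz] eq] .
  then have "j (f * h - f' * h') = j (r * (g * h))" by (simp only: j_eqs(4))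
  then have key: "f * h - f' * h' = r * (g * h)" using j_inj by (simp add: inj_eq)
  obtain z where z: "ev (g * h) z = ev g y" using ev_surj[OF h(2)] by blast
  let ?c = "\<lambda>x. \<gamma> x - x"
  note \<gamma>i = \<Gamma>_inertial[OF \<gamma>(1)]
  have 1: "v (ev f (?c (ev h z)) - ev f (?c y)) < 1"
  proof -
    have "v (?c (ev h z) - ?c y) < 1"
      by (rule defect_small[OF \<gamma>i g(1)]) (use z in \<open>simp add: ev_mult v\<close>)
    then show ?thesis using ev_maximal by (simp add: ev_diff[symmetric])
  qed
  have 2: "v (ev f' (?c (ev h' z)) - ev f' (?c y')) < 1"
  proof -
    have "ev g' (ev h' z) = ev g y" using z h(1) by (simp add: ev_mult[symmetric])
    then have "v (?c (ev h' z) - ?c y') < 1"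
      using defect_small[OF \<gamma>i g(2)] X_diff[OF y] by simp
    then show ?thesis using ev_maximal by (simp add: ev_diff[symmetric])
  qed
  have 3: "v (ev f' (?c y') - ev f' (\<gamma>' y' - y')) < 1"
  proof -
    have "v (?c y' - (\<gamma>' y' - y')) < 1" using \<Gamma>_diff[OF \<gamma> g(2) y(2)] by simp
    then show ?thesis using ev_maximal by (simp add: ev_diff[symmetric])
  qed
  have 4: "ev f (?c (ev h z)) = ev f' (?c (ev h' z))"
  proof -
    have "ev f (?c (ev h z)) - ev f' (?c (ev h' z)) = ev (f * h - f' * h') (?c z)"
      by (simp only: ev_minus ev_mult ev_defect[OF \<gamma>i, symmetric])
    also have "\<dots> = ev r (?c (ev (g * h) z))"
      unfolding key by (simp add: ev_mult ev_defect[OF \<gamma>i])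
    also have "\<dots> = 0" using z \<Gamma>_fixes[OF \<gamma>(1) y(1)] by (simp add: ev_zero)
    finally show ?thesis by simp
  qed
  show ?thesis
    using integral_closed(4)[OF integral_closed(3)[OF 2 3] 1] 4 by (simp add: algebra_simps)
qed

text \<open>
  The Kummer pairing over \<open>R\<close>, an element of \<open>Hom\<^sub>R(D/R, k\<^sup>a\<^sup>l\<^sup>g)\<close>. Its
  pullbacks are the pairings of the Drinfeld modules over \<open>k\<close>.
\<close>

definition kummer_map :: "'d set \<Rightarrow> 'a set" where
  "kummer_map = (\<lambda>Q\<in>quot UNIV (range j). the_elem
     {ev f (\<gamma> y - y) +o \<mm> | f g y \<gamma>.
        g \<noteq> 0 \<and> Q = (j f / j g) +o range j \<and> ev g y \<in> X \<and> \<gamma> \<in> \<Gamma>})"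

lemma kummer_map_eq:
  assumes "g \<noteq> 0" "ev g y \<in> X" "\<gamma> \<in> \<Gamma>"
  shows "kummer_map ((j f / j g) +o range j) = ev f (\<gamma> y - y) +o \<mm>"
proof -
  let ?Q = "(j f / j g) +o range j"
  have "{ev f (\<gamma> y - y) +o \<mm> | f g y \<gamma>.
      g \<noteq> 0 \<and> ?Q = (j f / j g) +o range j \<and> ev g y \<in> X \<and> \<gamma> \<in> \<Gamma>} = {ev f (\<gamma> y - y) +o \<mm>}"
    (is "?S = _")
  proof
    show "{ev f (\<gamma> y - y) +o \<mm>} \<subseteq> ?S" using assms by blast
    show "?S \<subseteq> {ev f (\<gamma> y - y) +o \<mm>}"
    proof
      fix Z assume "Z \<in> ?S"
      then obtain f' g' y' \<gamma>' where Z: "Z = ev f' (\<gamma>' y' - y') +o \<mm>" "g' \<noteq> 0"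
        "?Q = (j f' / j g') +o range j" "ev g' y' \<in> X" "\<gamma>' \<in> \<Gamma>"
        by blast
      have "j f' / j g' - j f / j g \<in> range j"
        using Z(3)[symmetric] by (simp only: coset_eq_iff[OF add_subgroups(1)])
      then have "v (ev f' (\<gamma>' y' - y') - ev f (\<gamma> y - y)) < 1"
        using kummer_value_well_defined[OF Z(2) assms(1) _ Z(4) assms(2) Z(5) assms(3)] by blast
      then show "Z \<in> {ev f (\<gamma> y - y) +o \<mm>}"
        by (simp add: Z(1) coset_eq_iff[OF add_subgroups(2)] \<mm>_iff)
    qed
  qed
  moreover have "?Q \<in> quot UNIV (range j)" by (simp add: quot_def)
  ultimately show ?thesis by (simp add: kummer_map_def)
qed

lemma kummer_map_in_R_homs: "kummer_map \<in> R_homs v \<iota> j"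
proof -
  obtain \<xi> \<gamma> where \<xi>: "\<xi> \<in> X" and \<gamma>: "\<gamma> \<in> \<Gamma>" using X_nonempty \<Gamma>_nonempty by blast
  note \<gamma>i = \<Gamma>_inertial[OF \<gamma>]
  have eq: "kummer_map ((j f / j g) +o range j) = ev f (\<gamma> y - y) +o \<mm>"
    if "g \<noteq> 0" "ev g y = \<xi>" for f g y
    using kummer_map_eq[OF that(1) _ \<gamma>] that(2) \<xi> by blast
  have rep: "\<exists>f g y. g \<noteq> 0 \<and> ev g y = \<xi> \<and> Q = (j f / j g) +o range j"
    if "Q \<in> quot UNIV (range j)" for Q
    using that j_frac ev_surj unfolding quot_def by (metis imageE)
  have ind_m: "induced (ev r) \<mm> (x +o \<mm>) = ev r x +o \<mm>" for r x
    by (rule induced_coset[OF add_subgroups(2,2)]) (simp add: ev_add \<mm>_iff ev_maximal)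
  have ind_j: "induced (\<lambda>x. j r * x) (range j) (x +o range j) = (j r * x) +o range j" for r x
    by (rule induced_coset[OF add_subgroups(1,1)]) (auto simp: distrib_left j_eqs(4)[symmetric])
  show ?thesis
    unfolding R_homs_def quot_homs_def
  proof (intro CollectI conjI ballI)
    show "kummer_map \<in> quot UNIV (range j) \<rightarrow>\<^sub>E quot \<O> \<mm>"
    proof (rule PiE_I)
      fix Q assume "Q \<in> quot UNIV (range j)"
      then obtain f g y where Q: "g \<noteq> 0" "ev g y = \<xi>" "Q = (j f / j g) +o range j"
        using rep by blast
      have "v (ev f (\<gamma> y - y)) \<le> 1"
        using defect_integral[OF \<gamma>i Q(1)] Q(2) \<Gamma>_fixes[OF \<gamma> \<xi>] by (intro ev_integral) simp
      then show "kummer_map Q \<in> quot \<O> \<mm>"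
        using eq[OF Q(1,2)] Q(3) by (auto simp: quot_def \<O>_iff)
    qed (simp add: kummer_map_def)
    fix Q Q' assume "Q \<in> quot UNIV (range j)" "Q' \<in> quot UNIV (range j)"
    then obtain f g y f' g' y' where Q: "g \<noteq> 0" "ev g y = \<xi>" "Q = (j f / j g) +o range j"
      and Q': "g' \<noteq> 0" "ev g' y' = \<xi>" "Q' = (j f' / j g') +o range j"
      using rep by meson
    obtain h h' where h: "g * h = g' * h'" "g * h \<noteq> 0"
      using skew_common_right_multiple[OF Q(1) Q'(1)] by blast
    then have h0: "h \<noteq> 0" "h' \<noteq> 0" by auto
    obtain z where z: "ev (g * h) z = \<xi>" using ev_surj[OF h(2)] by blast
    have QQ: "Q = (j (f * h) / j (g * h)) +o range j" "Q' = (j (f' * h') / j (g * h)) +o range j"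
      using Q(3) Q'(3) j_expand[OF h0(1) Q(1)] j_expand[OF h0(2) Q'(1)] h(1) by auto
    then have "Q + Q' = (j (f * h + f' * h') / j (g * h)) +o range j"
      by (simp add: coset_plus[OF add_subgroups(1)] add_divide_distrib j_eqs)
    then show "kummer_map (Q + Q') = kummer_map Q + kummer_map Q'"
      using eq[OF h(2) z] QQ by (simp add: coset_plus[OF add_subgroups(2)] ev_plus)
  next
    fix r Q assume "Q \<in> quot UNIV (range j)"
    then obtain f g y where Q: "g \<noteq> 0" "ev g y = \<xi>" "Q = (j f / j g) +o range j"
      using rep by blast
    have "induced (\<lambda>x. j r * x) (range j) Q = (j (r * f) / j g) +o range j"
      by (simp add: Q(3) ind_j j_eqs)
    then show "kummer_map (induced (\<lambda>x. j r * x) (range j) Q) = induced (ev r) \<mm> (kummer_map Q)"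
      using eq[OF Q(1,2)] by (simp add: Q(3) ind_m ev_mult)
  qed
qed

end


section \<open>Comparison with the pairings of Drinfeld modules\<close>

locale drinfeld_kummer = kummer_class v \<iota> j X \<Gamma>
  for v :: "'a::alg_closed_field \<Rightarrow> real" and \<iota> :: "'k::finite_field \<Rightarrow> 'a"
    and j :: "'k skew_poly \<Rightarrow> 'd::division_ring" and X :: "'a set" and \<Gamma> :: "('a \<Rightarrow> 'a) set" +
  fixes A :: "'f::field set" and \<phi> :: "'f \<Rightarrow> 'k skew_poly"
  assumes A: "is_subring A" and \<phi>: "drinfeld_module A \<phi>"
    and \<phi>_inj: "a \<in> A \<Longrightarrow> a \<noteq> 0 \<Longrightarrow> \<phi> a \<noteq> 0"
    and fractions: "\<exists>a\<in>A. \<exists>b\<in>A. a \<noteq> 0 \<and> x = b / a"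
begin

lemma \<phi>_hom: "ring_hom_on A \<phi>" using \<phi> by (simp add: drinfeld_module_def)

lemmas \<phi>_eqs = ring_hom_on_eqs[OF A \<phi>_hom]
lemmas A_mem = is_subringD[OF A]

lemma add_subgroup_A: "add_subgroup A" by (rule is_subring_add_subgroup[OF A])

lemma quot_A_cases:
  assumes "Q \<in> quot UNIV A"
  obtains a b where "a \<in> A" "b \<in> A" "a \<noteq> 0" "Q = (b / a) +o A"
proof -
  obtain x where "Q = x +o A" using assms by (auto simp: quot_def)
  then show thesis using fractions[of x] that by blast
qed

text \<open>
  The map \<open>F/A \<rightarrow> D/R\<close> induced by \<open>\<phi>\<close> is well defined. The values of \<open>\<phi>\<close> commute with each
  other, so the computation is the commutative one.
\<close>

lemma fraction_coset_transport:
  assumes a: "a \<in> A" "b \<in> A" "a \<noteq> 0" "a' \<in> A" "b' \<in> A" "a' \<noteq> 0"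
    and eq: "(b / a) +o A = (b' / a') +o A"
  shows "(j (\<phi> b) / j (\<phi> a)) +o range j = (j (\<phi> b') / j (\<phi> a')) +o range j"
proof -
  have "b / a - b' / a' \<in> A" using eq by (simp add: coset_eq_iff[OF add_subgroup_A])
  then obtain c where c: "c \<in> A" "b / a - b' / a' = c" by blast
  then have "b * a' - b' * a = c * (a * a')" using a by (simp add: field_simps)
  then have "\<phi> (b * a' - b' * a) = \<phi> (c * (a * a'))" by simp
  then have 1: "\<phi> b * \<phi> a' - \<phi> b' * \<phi> a = \<phi> c * (\<phi> a * \<phi> a')"
    using a c(1) by (simp add: \<phi>_eqs A_mem)
  have 2: "\<phi> a' * \<phi> a = \<phi> a * \<phi> a'" using a by (simp add: \<phi>_eqs(4)[symmetric] mult.commute)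
  note n = \<phi>_inj[OF a(1,3)] \<phi>_inj[OF a(4,6)]
  have "j (\<phi> b) / j (\<phi> a) - j (\<phi> b') / j (\<phi> a') = j (\<phi> b * \<phi> a' - \<phi> b' * \<phi> a) / j (\<phi> a * \<phi> a')"
    using j_expand[OF n(2,1), of "\<phi> b"] j_expand[OF n(1,2), of "\<phi> b'"]
    by (simp only: 2 j_eqs(6) diff_divide_distrib)
  also have "\<dots> = j (\<phi> c)"
    using n by (simp add: 1 j_eqs j_eq_0_iff divide_inverse nonzero_inverse_mult_distrib
        mult.assoc) (simp add: mult.assoc[symmetric] j_eq_0_iff)
  finally show ?thesis by (simp add: coset_eq_iff[OF add_subgroups(1)])
qed

text \<open>
  The pairing of \<open>\<phi>\<close> is the restriction of the pairing over \<open>R\<close> along \<open>F/A \<rightarrow> D/R\<close>: a fraction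
  \<open>b/a\<close> goes to \<open>\<phi>\<^sub>b \<phi>\<^sub>a\<^sup>-\<^sup>1\<close>, and both sides are computed from a root of \<open>\<phi>\<^sub>a x = \<xi>\<close>. Hence it
  inherits its independence of all choices.
\<close>

lemma kummer_pairing_rep_eq:
  assumes a: "a \<in> A" "b \<in> A" "a \<noteq> 0" and \<xi>: "\<xi> \<in> X" and \<gamma>: "\<gamma> \<in> \<Gamma>"
  shows "kummer_pairing_rep v \<iota> A \<phi> \<xi> \<gamma> ((b / a) +o A) =
    kummer_map ((j (\<phi> b) / j (\<phi> a)) +o range j)"
proof -
  let ?Q = "(b / a) +o A" and ?V = "kummer_map ((j (\<phi> b) / j (\<phi> a)) +o range j)"
  have val: "ev (\<phi> b') (\<gamma> x - x) +o \<mm> = kummer_map ((j (\<phi> b') / j (\<phi> a')) +o range j)"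
    if "a' \<in> A" "a' \<noteq> 0" "ev (\<phi> a') x = \<xi>" for a' b' x
  proof -
    have "ev (\<phi> a') x \<in> X" using that(3) \<xi> by simp
    from kummer_map_eq[OF \<phi>_inj[OF that(1,2)] this \<gamma>] show ?thesis by simp
  qed
  have "{ev (\<phi> b') (\<gamma> x - x) +o \<mm> | a' b' x.
      a' \<in> A \<and> b' \<in> A \<and> a' \<noteq> 0 \<and> ?Q = (b' / a') +o A \<and> ev (\<phi> a') x = \<xi>} = {?V}" (is "?S = _")
  proof
    show "?S \<subseteq> {?V}"
      using val fraction_coset_transport[OF a] by auto
    obtain x where "ev (\<phi> a) x = \<xi>" using ev_surj[OF \<phi>_inj[OF a(1,3)]] by blast
    then show "{?V} \<subseteq> ?S" using val[OF a(1,3), of x b] a by blast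
  qed
  then show ?thesis by (simp add: kummer_pairing_rep_def quot_def)
qed

text \<open>
  The common value of the pairing on all representatives; the choice of \<open>\<xi>\<close> and \<open>\<gamma>\<close> is immaterial
  by \<open>kummer_pairing_rep_eq_pairing\<close>.
\<close>

definition pairing :: "'f set \<Rightarrow> 'a set" where
  "pairing = kummer_pairing_rep v \<iota> A \<phi> (SOME \<xi>. \<xi> \<in> X) (SOME \<gamma>. \<gamma> \<in> \<Gamma>)"

lemma pairing_eq:
  assumes "a \<in> A" "b \<in> A" "a \<noteq> 0"
  shows "pairing ((b / a) +o A) = kummer_map ((j (\<phi> b) / j (\<phi> a)) +o range j)"
  unfolding pairing_def
  using kummer_pairing_rep_eq[OF assms] X_nonempty \<Gamma>_nonempty by (simp add: some_in_eq)

lemma kummer_pairing_rep_eq_pairing: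
  assumes "\<xi> \<in> X" "\<gamma> \<in> \<Gamma>"
  shows "kummer_pairing_rep v \<iota> A \<phi> \<xi> \<gamma> = pairing"
proof
  fix Q
  show "kummer_pairing_rep v \<iota> A \<phi> \<xi> \<gamma> Q = pairing Q"
  proof (cases "Q \<in> quot UNIV A")
    case True
    then show ?thesis using quot_A_cases kummer_pairing_rep_eq[OF _ _ _ assms] pairing_eq by metis
  qed (simp add: pairing_def kummer_pairing_rep_def)
qed

lemma kummer_pairing_eq_pairing:
  assumes "\<Union>C = \<Gamma>"
  shows "kummer_pairing v \<iota> A \<phi> X C = pairing"
proof -
  have "{kummer_pairing_rep v \<iota> A \<phi> \<xi> \<gamma> | \<xi> \<gamma>. \<xi> \<in> X \<and> \<gamma> \<in> \<Union>C} =
      (\<lambda>(\<xi>, \<gamma>). kummer_pairing_rep v \<iota> A \<phi> \<xi> \<gamma>) ` (X \<times> \<Gamma>)"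
    by (auto simp: assms)
  also have "\<dots> = (\<lambda>_. pairing) ` (X \<times> \<Gamma>)"
    by (rule image_cong) (auto simp: kummer_pairing_rep_eq_pairing)
  also have "\<dots> = {pairing}" using X_nonempty \<Gamma>_nonempty by auto
  finally show ?thesis by (simp add: kummer_pairing_def)
qed

lemma pairing_in_T_ad: "pairing \<in> T_ad v \<iota> A \<phi>"
proof -
  obtain \<xi> \<gamma> where \<xi>: "\<xi> \<in> X" and \<gamma>: "\<gamma> \<in> \<Gamma>" using X_nonempty \<Gamma>_nonempty by blast
  have eq: "pairing ((b / a) +o A) = ev (\<phi> b) (\<gamma> y - y) +o \<mm>"
    if "a \<in> A" "b \<in> A" "a \<noteq> 0" "ev (\<phi> a) y = \<xi>" for a b y
    using pairing_eq[OF that(1-3)] kummer_map_eq[OF \<phi>_inj[OF that(1,3)] _ \<gamma>] that(4) \<xi> by simp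
  have ind_m: "induced (ev r) \<mm> (x +o \<mm>) = ev r x +o \<mm>" for r x
    by (rule induced_coset[OF add_subgroups(2,2)]) (simp add: ev_add \<mm>_iff ev_maximal)
  have ind_A: "induced ((*) r) A (x +o A) = (r * x) +o A" if "r \<in> A" for r x
    by (rule induced_coset[OF add_subgroup_A add_subgroup_A])
      (use that in \<open>simp add: distrib_left A_mem\<close>)
  show ?thesis
    unfolding T_ad_def quot_homs_def
  proof (intro CollectI conjI ballI)
    show "pairing \<in> quot UNIV A \<rightarrow>\<^sub>E quot UNIV \<mm>"
    proof (rule PiE_I)
      fix Q assume "Q \<in> quot UNIV A"
      then obtain a b where Q: "a \<in> A" "b \<in> A" "a \<noteq> 0" "Q = (b / a) +o A" by (rule quot_A_cases)
      obtain y where "ev (\<phi> a) y = \<xi>" using ev_surj[OF \<phi>_inj[OF Q(1,3)]] by blast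
      then show "pairing Q \<in> quot UNIV \<mm>" using eq[OF Q(1-3)] Q(4) by (auto simp: quot_def)
    qed (simp add: pairing_def kummer_pairing_rep_def)
    fix Q Q' assume QQ: "Q \<in> quot UNIV A" "Q' \<in> quot UNIV A"
    obtain a b where Q: "a \<in> A" "b \<in> A" "a \<noteq> 0" "Q = (b / a) +o A"
      using QQ(1) by (rule quot_A_cases)
    obtain a' b' where Q': "a' \<in> A" "b' \<in> A" "a' \<noteq> 0" "Q' = (b' / a') +o A"
      using QQ(2) by (rule quot_A_cases)
    have aa: "a * a' \<in> A" "a * a' \<noteq> 0" and mem: "b * a' \<in> A" "b' * a \<in> A" "b * a' + b' * a \<in> A"
      using Q Q' by (auto intro: A_mem)
    have frac: "Q = (b * a' / (a * a')) +o A" "Q' = (b' * a / (a * a')) +o A"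
      using Q(3,4) Q'(3,4) by (auto simp: field_simps)
    then have sum: "Q + Q' = ((b * a' + b' * a) / (a * a')) +o A"
      by (simp add: coset_plus[OF add_subgroup_A] add_divide_distrib)
    obtain y where y: "ev (\<phi> (a * a')) y = \<xi>" using ev_surj[OF \<phi>_inj[OF aa]] by blast
    have "pairing Q = ev (\<phi> (b * a')) (\<gamma> y - y) +o \<mm>"
      unfolding frac(1) by (rule eq[OF aa(1) mem(1) aa(2) y])
    moreover have "pairing Q' = ev (\<phi> (b' * a)) (\<gamma> y - y) +o \<mm>"
      unfolding frac(2) by (rule eq[OF aa(1) mem(2) aa(2) y])
    moreover have "pairing (Q + Q') = ev (\<phi> (b * a' + b' * a)) (\<gamma> y - y) +o \<mm>"
      unfolding sum by (rule eq[OF aa(1) mem(3) aa(2) y])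
    ultimately show "pairing (Q + Q') = pairing Q + pairing Q'"
      by (simp add: coset_plus[OF add_subgroups(2)] ev_plus \<phi>_eqs(3)[OF mem(1,2)])
  next
    fix r Q assume r: "r \<in> A" and "Q \<in> quot UNIV A"
    then obtain a b where Q: "a \<in> A" "b \<in> A" "a \<noteq> 0" "Q = (b / a) +o A"
      using quot_A_cases by blast
    obtain y where y: "ev (\<phi> a) y = \<xi>" using ev_surj[OF \<phi>_inj[OF Q(1,3)]] by blast
    have "induced ((*) r) A Q = ((r * b) / a) +o A" using r by (simp add: Q(4) ind_A)
    then show "pairing (induced ((*) r) A Q) = induced (ev (\<phi> r)) \<mm> (pairing Q)"
      using eq[OF Q(1) A_mem(6)[OF r Q(2)] Q(3) y] eq[OF Q(1-3) y] Q(4) r Q(2)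
      by (simp add: ind_m \<phi>_eqs(4) ev_mult)
  qed
qed

lemma adjoint_pairing: "adjoint v \<iota> j A \<phi> pairing kummer_map"
  unfolding adjoint_def
proof (intro conjI allI ballI)
  show "pairing \<in> T_ad v \<iota> A \<phi>" by (rule pairing_in_T_ad)
  show "kummer_map \<in> R_homs v \<iota> j" by (rule kummer_map_in_R_homs)
  fix f a assume "a \<in> A - {0}"
  then have a: "a \<in> A" "1 \<in> A" "a \<noteq> 0" using A_mem(2) by auto
  obtain \<xi> \<gamma> where \<xi>: "\<xi> \<in> X" and \<gamma>: "\<gamma> \<in> \<Gamma>" using X_nonempty \<Gamma>_nonempty by blast
  obtain y where y: "ev (\<phi> a) y = \<xi>" using ev_surj[OF \<phi>_inj[OF a(1,3)]] by blast
  have eq: "kummer_map ((j h / j (\<phi> a)) +o range j) = ev h (\<gamma> y - y) +o \<mm>" for h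
    using kummer_map_eq[OF \<phi>_inj[OF a(1,3)] _ \<gamma>] y \<xi> by simp
  have "pairing ((1 / a) +o A) = (\<gamma> y - y) +o \<mm>"
    using pairing_eq[OF a] eq[of "\<phi> 1"] by (simp add: \<phi>_eqs ev_one)
  moreover have "induced (ev f) \<mm> ((\<gamma> y - y) +o \<mm>) = ev f (\<gamma> y - y) +o \<mm>"
    by (rule induced_coset[OF add_subgroups(2,2)]) (simp add: ev_add \<mm>_iff ev_maximal)
  ultimately show "kummer_map ((j f / j (\<phi> a)) +o range j) =
      induced (ev f) \<mm> (pairing ((1 / a) +o A))"
    using eq by simp
qed

lemma fraction_with_denominator_in_A: "\<exists>f. \<exists>a\<in>A - {0}. x = j f / j (\<phi> a)"
proof -
  obtain f g where fg: "g \<noteq> 0" "x = j f / j g" using j_frac by blast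
  obtain a q where a: "a \<in> A" "\<phi> a \<noteq> 0" "\<phi> a = g * q"
    using drinfeld_right_multiple[OF \<phi> A fg(1)] by blast
  then have "q \<noteq> 0" "a \<noteq> 0" using \<phi>_eqs(1) by auto
  then show ?thesis using a fg j_expand[OF \<open>q \<noteq> 0\<close> fg(1), of f] by (metis DiffI singletonD)
qed

text \<open>
  Every element of \<open>D\<close> has a denominator \<open>\<phi>\<^sub>a\<close>, so the condition of adjointness prescribes all
  values of the homomorphism on \<open>D/R\<close>.
\<close>

lemma adjoint_determines_R_hom:
  assumes "adjoint v \<iota> j A \<phi> l \<Lambda>" "adjoint v \<iota> j A \<phi> l \<Lambda>'"
  shows "\<Lambda> = \<Lambda>'"
proof
  fix Q
  have ext: "\<Lambda> \<in> extensional (quot UNIV (range j))" "\<Lambda>' \<in> extensional (quot UNIV (range j))"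
    using assms by (auto simp: adjoint_def R_homs_def quot_homs_def PiE_def)
  show "\<Lambda> Q = \<Lambda>' Q"
  proof (cases "Q \<in> quot UNIV (range j)")
    case True
    then obtain x where "Q = x +o range j" by (auto simp: quot_def)
    moreover obtain f a where "a \<in> A - {0}" "x = j f / j (\<phi> a)"
      using fraction_with_denominator_in_A by blast
    ultimately show ?thesis using assms by (simp add: adjoint_def)
  qed (use ext in \<open>simp add: extensional_def\<close>)
qed

lemma adjoint_determines_A_hom:
  assumes "adjoint v \<iota> j A \<phi> l \<Lambda>" "adjoint v \<iota> j A \<phi> l' \<Lambda>"
  shows "l = l'"
proof
  fix Q
  have l: "l \<in> T_ad v \<iota> A \<phi>" "l' \<in> T_ad v \<iota> A \<phi>" using assms by (auto simp: adjoint_def)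
  show "l Q = l' Q"
  proof (cases "Q \<in> quot UNIV A")
    case True
    then obtain a b where Q: "a \<in> A" "b \<in> A" "a \<noteq> 0" "Q = (b / a) +o A" by (rule quot_A_cases)
    have ind: "induced ((*) b) A ((1 / a) +o A) = Q"
      unfolding Q(4) using Q(2) by (subst induced_coset[OF add_subgroup_A add_subgroup_A])
        (simp_all add: distrib_left A_mem)
    have "m Q = induced (ev (\<phi> b)) \<mm> (m ((1 / a) +o A))" if "m \<in> T_ad v \<iota> A \<phi>" for m
    proof -
      have "m (induced ((*) b) A ((1 / a) +o A)) = induced (ev (\<phi> b)) \<mm> (m ((1 / a) +o A))"
        using that Q(2) by (simp add: T_ad_def quot_homs_def quot_def)
      then show ?thesis by (simp only: ind)
    qed
    then have "l Q = induced (ev (\<phi> b)) \<mm> (l ((1 / a) +o A))"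
      "l' Q = induced (ev (\<phi> b)) \<mm> (l' ((1 / a) +o A))"
      using l by blast+
    then show ?thesis using assms Q(1,3) by (simp add: adjoint_def)
  next
    case False
    then show ?thesis
      using l by (auto simp: T_ad_def quot_homs_def PiE_def extensional_def)
  qed
qed

end

text \<open>
  Both pairings are adjoint to the same homomorphism on \<open>D/R\<close>, and adjoints are unique on either
  side.
\<close>

lemma theta_pairing:
  assumes \<phi>: "drinfeld_kummer v \<iota> j X \<Gamma> A \<phi>" and \<omega>: "drinfeld_kummer v \<iota> j X \<Gamma> B \<omega>"
    and C: "\<Union>C = \<Gamma>"
  shows "theta v \<iota> j A \<phi> B \<omega> (kummer_pairing v \<iota> A \<phi> X C) = kummer_pairing v \<iota> B \<omega> X C"
proof -
  interpret \<phi>: drinfeld_kummer v \<iota> j X \<Gamma> A \<phi> by (rule \<phi>)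
  interpret \<omega>: drinfeld_kummer v \<iota> j X \<Gamma> B \<omega> by (rule \<omega>)
  have "theta v \<iota> j A \<phi> B \<omega> \<phi>.pairing = \<omega>.pairing"
    unfolding theta_def
  proof (rule the_equality)
    show "\<exists>\<Lambda>. adjoint v \<iota> j A \<phi> \<phi>.pairing \<Lambda> \<and> adjoint v \<iota> j B \<omega> \<omega>.pairing \<Lambda>"
      using \<phi>.adjoint_pairing \<omega>.adjoint_pairing by blast
    fix l assume "\<exists>\<Lambda>. adjoint v \<iota> j A \<phi> \<phi>.pairing \<Lambda> \<and> adjoint v \<iota> j B \<omega> l \<Lambda>"
    then obtain \<Lambda> where "adjoint v \<iota> j A \<phi> \<phi>.pairing \<Lambda>" "adjoint v \<iota> j B \<omega> l \<Lambda>" by blast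
    then have "adjoint v \<iota> j B \<omega> l \<phi>.kummer_map"
      using \<phi>.adjoint_determines_R_hom[OF _ \<phi>.adjoint_pairing] by blast
    then show "l = \<omega>.pairing"
      using \<omega>.adjoint_determines_A_hom[OF _ \<omega>.adjoint_pairing] by blast
  qed
  then show ?thesis
    using \<phi>.kummer_pairing_eq_pairing[OF C] \<omega>.kummer_pairing_eq_pairing[OF C] by simp
qed


section \<open>Identification of the local Kummer pairings\<close>

theorem proposition10p5:
  fixes p d :: nat
    and K :: "'a::alg_closed_field set"
    and v :: "'a \<Rightarrow> real"
    and res :: "'a \<Rightarrow> 'k::finite_field"
    and \<iota> :: "'k \<Rightarrow> 'a"
    and infty A :: "'f::field set"
    and \<phi> :: "'f \<Rightarrow> 'k skew_poly"
    and \<omega> :: "'p::finite_field poly fract \<Rightarrow> 'k skew_poly"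
    and j :: "'k skew_poly \<Rightarrow> 'd::division_ring"
  assumes "prime p" and "CHAR('a) = p" and "CARD('k) = p ^ d"
    and "local_field v K res"
    and "residue_section v K res \<iota>"
    and "CARD('p) = p"
    and "global_function_field TYPE('p) TYPE('f)"
    and "infty \<in> places" and "A = regular_outside infty"
    and "drinfeld_module A \<phi>"
    and "basic_drinfeld_module d \<omega>"
    and "total_quotient_ring j"
  shows "\<forall>X\<in>quot (perfection K) (val_ring v (perfection K)). \<forall>C\<in>carrier (J_group v K).
           theta v \<iota> j A \<phi> poly_subring \<omega> (kummer_pairing v \<iota> A \<phi> X C) =
           kummer_pairing v \<iota> poly_subring \<omega> X C"
proof (intro ballI)
  fix X C
  assume X: "X \<in> quot (perfection K) (val_ring v (perfection K))"
    and C: "C \<in> carrier (J_group v K)"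
  have abs_value: "nonarch_absolute_value v" using assms(4) by (simp add: local_field_def)
  have \<iota>: "ring_hom_on UNIV \<iota>" "range \<iota> \<subseteq> val_ring v K"
    using assms(5) by (auto simp: residue_section_def)
  interpret residue_action v \<iota>
    by standard (use abs_value \<iota> in \<open>auto simp: val_ring_def\<close>)
  have \<iota>_K: "range \<iota> \<subseteq> K" using \<iota>(2) by (auto simp: val_ring_def)
  have p: "CHAR('k) = p" using CHAR_eq assms(2) by simp
  note inertia = inertia_groupD[OF \<iota>_K]
  obtain x where x: "x \<in> perfection K" "X = x +o val_ring v (perfection K)"
    using X by (auto simp: quot_def)
  have fixed: "\<gamma> \<xi> = \<xi>" if "\<gamma> \<in> carrier (inertia_group v K)" "\<xi> \<in> X" for \<gamma> \<xi>
  proof -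
    obtain o' where o: "o' \<in> perfection K" "\<xi> = x + o'"
      using \<open>\<xi> \<in> X\<close> x(2) by (auto simp: elt_set_plus_def val_ring_def)
    then show ?thesis
      using inertia(3)[OF that(1)] x(1) ring_hom_on_eqs(3)[OF is_subring_UNIV inertia(2)[OF that(1)]]
      by simp
  qed
  have defect: "v (\<gamma> y - y) \<le> 1" if "g \<noteq> 0" "ev g y \<in> X" "\<gamma> \<in> carrier (inertia_group v K)" for g y \<gamma>
    using defect_integral[OF inertia(4)[OF that(3)] that(1)] fixed[OF that(3,2)] by simp
  have kummer_class: "kummer_class v \<iota> j X (\<Union>C)"
  proof unfold_locales
    show "total_quotient_ring j" by (rule assms(12))
    show "\<Union>C \<noteq> {}" by (rule J_group_class_nonempty[OF \<iota>_K C])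
    have "0 \<in> K" using assms(4) by (simp add: local_field_def is_subfield_def is_subring_def)
    then have "0 \<in> val_ring v (perfection K)"
      by (auto simp: val_ring_def perfection_def nonarch_absolute_valueD(5)[OF abs_value]
          intro!: exI[of _ 0])
    then have "x + 0 \<in> X" unfolding x(2) by (rule set_plus_intro2)
    then show "X \<noteq> {}" by blast
    show "v (\<xi> - \<xi>') \<le> 1" if "\<xi> \<in> X" "\<xi>' \<in> X" for \<xi> \<xi>'
      using that x(2) integral_closed(2) by (auto simp: elt_set_plus_def val_ring_def)
    show "v (\<gamma> y - \<gamma>' y) < 1"
      if "\<gamma> \<in> \<Union>C" "\<gamma>' \<in> \<Union>C" "g \<noteq> 0" "ev g y \<in> X" for \<gamma> \<gamma>' g y
      by (rule J_group_class_defect(2)[OF \<iota>_K _ C that(1,2)]) (rule defect[OF that(3,4)])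
    have mem: "\<gamma> \<in> carrier (inertia_group v K)" if "\<gamma> \<in> \<Union>C" for \<gamma>
    proof -
      have "v (\<delta> 0 - 0) \<le> 1" if "\<delta> \<in> carrier (inertia_group v K)" for \<delta>
        using ring_hom_on_eqs(1)[OF is_subring_UNIV inertia(2)[OF that]] nonarch_absolute_valueD(5)[OF abs_value]
        by simp
      then show ?thesis
        by (rule J_group_class_defect(1)[OF \<iota>_K _ C \<open>\<gamma> \<in> \<Union>C\<close> \<open>\<gamma> \<in> \<Union>C\<close>])
    qed
    show "inertial \<gamma>" if "\<gamma> \<in> \<Union>C" for \<gamma> by (rule inertia(4)[OF mem[OF that]])
    show "\<gamma> \<xi> = \<xi>" if "\<gamma> \<in> \<Union>C" "\<xi> \<in> X" for \<gamma> \<xi> by (rule fixed[OF mem[OF that(1)] that(2)])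
  qed
  have A: "is_subring A" unfolding assms(9) by (rule is_subring_regular_outside)
  have \<omega>: "drinfeld_module poly_subring \<omega>" using assms(11) by (simp add: basic_drinfeld_module_def)
  have "drinfeld_kummer v \<iota> j X (\<Union>C) A \<phi>"
  proof (intro drinfeld_kummer.intro drinfeld_kummer_axioms.intro)
    show "\<exists>a\<in>A. \<exists>b\<in>A. a \<noteq> 0 \<and> x = b / a" for x
      using fraction_of_regular[OF assms(6) p assms(7), of infty \<phi>] assms(10) unfolding assms(9) by blast
  qed (use kummer_class A assms(10) drinfeld_injective[OF assms(6) p assms(7) A assms(10)] in auto)
  moreover have "drinfeld_kummer v \<iota> j X (\<Union>C) poly_subring \<omega>"
  proof (intro drinfeld_kummer.intro drinfeld_kummer_axioms.intro)
    show "\<exists>a\<in>poly_subring. \<exists>b\<in>poly_subring. a \<noteq> 0 \<and> x = b / a" for x :: "'p poly fract"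
      by (rule fraction_of_poly_subring)
    show "\<omega> a \<noteq> 0" if "a \<in> poly_subring" "a \<noteq> 0" for a
      by (rule drinfeld_injective[OF assms(6) p global_function_field_poly_fract
            is_subring_poly_subring \<omega> that])
  qed (use kummer_class \<omega> is_subring_poly_subring in auto)
  ultimately show "theta v \<iota> j A \<phi> poly_subring \<omega> (kummer_pairing v \<iota> A \<phi> X C) =
      kummer_pairing v \<iota> poly_subring \<omega> X C"
    by (rule theta_pairing) simp
qed

end
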